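(* Let $\lambda_1,\lambda_2\ge0$ and $\vec\lambda=(\lambda_1,\lambda_2)$. Let $(\mathcal M,\rho)$ be a finite pseudometric space, and let $F$ be a set-valued mapping assigning to each $x\in\mathcal M$ a nonempty convex closed set $F(x)\subset\mathbb R^2$. (i) If the $\vec\lambda$-Projection Algorithm produces the outcome "No go", then there does not exist a Lipschitz selection of $F$ with Lipschitz seminorm at most $\min\{\lambda_1,\lambda_2\}$. (ii) Suppose that the $\vec\lambda$-Projection Algorithm produces the outcome "Success". Then it returns the mapping $f_{\vec\lambda;F}:\mathcal M\to\mathbb R^2$ with the following properties: (A) $f_{\vec\lambda;F}$ is well defined, i.e.: (a) for every $x\in\mathcal M$ the set $F^{[1]}[x:\lambda_1]$ and the rectangle $\mathcal T^{[1]}_{F,\lambda_1}[x:\lambda_2]$ are nonempty; (b) the mapping $g_F$ is well defined; (c) for every $x\in\mathcal M$ the metric projection $\mathbf{Pr}(g_F(x),F^{[1]}[x:\lambda_1])$ is a singleton. (B) $f_{\vec\lambda;F}$ is a Lipschitz selection of $F$ with $\|f_{\vec\lambda;F}\|_{\mathrm{Lip}(\mathcal M)}\le\lambda_1+2\lambda_2$.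
   Context: A pseudometric on $\mathcal M$ is a function $\rho:\mathcal M\times\mathcal M\to[0,+\infty]$ with $\rho(x,x)=0$, $\rho(x,y)=\rho(y,x)$ and $\rho(x,y)\le\rho(x,z)+\rho(z,y)$ (zero distance between distinct points and the value $+\infty$ are allowed); "finite pseudometric space" means $\mathcal M$ is finite. $\|\cdot\|$ is the uniform norm on $\mathbb R^2$, $\|x\|=\max\{|x_1|,|x_2|\}$, $Q_0=[-1,1]^2$, $Q(a,r)=\{y:\|y-a\|\le r\}$, $A+B$ is the Minkowski sum. For $f:\mathcal M\to\mathbb R^2$, $\|f\|_{\mathrm{Lip}(\mathcal M)}=\inf\{\lambda\ge0:\|f(x)-f(y)\|\le\lambda\rho(x,y)\ \forall x,y\in\mathcal M\}$. If $\rho(x,y)=+\infty$ then (for every $\lambda\ge0$) the inequality $\|f(x)-f(y)\|\le\lambda\rho(x,y)$ is no constraint, and $A+\lambda\rho(x,y)Q_0=\mathbb R^2$ for nonempty $A$. A selection of $F$ is a map $f:\mathcal M\to\mathbb R^2$ with $f(x)\in F(x)$ for all $x$; it is Lipschitz if $\|f\|_{\mathrm{Lip}(\mathcal M)}<\infty$. A rectangle is a set $I_1\times I_2$ with $I_1,I_2\subset\mathbb R$ nonempty closed intervals (points and unbounded intervals allowed). For nonempty convex $S\subset\mathbb R^2$, $\mathcal H[S]$ is the smallest closed rectangle containing $S$. For nonempty closed convex $S$ and $a\in\mathbb R^2$, $\mathbf{Pr}(a,S)=S\cap Q(a,\mathrm{dist}(a,S))$ is the metric projection in the uniform norm (a set;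 identified with its element when it is a singleton). $O=(0,0)$. The $\vec\lambda$-Projection Algorithm: Step 1: for $x\in\mathcal M$ let $F^{[1]}[x:\lambda_1]=\bigcap_{y\in\mathcal M}[F(y)+\lambda_1\rho(x,y)Q_0]$; if this is empty for some $x$, the outcome is "No go" and the algorithm stops. Step 2: let $\mathcal T_{F,\lambda_1}(x)=\mathcal H[F^{[1]}[x:\lambda_1]]$. Step 3: let $\mathcal T^{[1]}_{F,\lambda_1}[x:\lambda_2]=\bigcap_{y\in\mathcal M}[\mathcal T_{F,\lambda_1}(y)+\lambda_2\rho(x,y)Q_0]$; if this is empty for some $x$, the outcome is "No go" and the algorithm stops. Step 4: let $g_F(x)$ be the center (of symmetry) of $\mathbf{Pr}(O,\mathcal T^{[1]}_{F,\lambda_1}[x:\lambda_2])$. Step 5: let $f_{\vec\lambda;F}(x)=\mathbf{Pr}(g_F(x),F^{[1]}[x:\lambda_1])$; the outcome is "Success" and $f_{\vec\lambda;F}$ is returned. *)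

theory Defs
  imports "HOL-Analysis.Analysis" "HOL-Library.Set_Algebras"
begin

definition pseudometric_on :: "'a set \<Rightarrow> ('a \<Rightarrow> 'a \<Rightarrow> ennreal) \<Rightarrow> bool" where
  "pseudometric_on M \<rho> \<longleftrightarrow>
     (\<forall>x\<in>M. \<rho> x x = 0) \<and>
     (\<forall>x\<in>M. \<forall>y\<in>M. \<rho> x y = \<rho> y x) \<and>
     (\<forall>x\<in>M. \<forall>y\<in>M. \<forall>z\<in>M. \<rho> x y \<le> \<rho> x z + \<rho> z y)"

text \<open>
  The factor \<open>l \<rho>(x,y)\<close> with the convention that it is infinite whenever \<open>\<rho>(x,y)\<close> is, also
  for \<open>l = 0\<close>. Multiplication on \<^typ>\<open>ennreal\<close> would give \<open>0 * \<infinity> = 0\<close> instead.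
\<close>
definition scaled_dist :: "real \<Rightarrow> ennreal \<Rightarrow> ennreal" where
  "scaled_dist l r = (if r = top then top else ennreal l * r)"

text \<open>
  The uniform norm is the library's \<^const>\<open>infnorm\<close>; by \<open>infnorm_2\<close> it is
  \<open>max \<bar>x $ 1\<bar> \<bar>x $ 2\<bar>\<close> on \<^typ>\<open>real^2\<close>. The metric notions of the type class (\<^const>\<open>dist\<close>,
  \<^const>\<open>cball\<close>, \<^const>\<open>infdist\<close>) are Euclidean and are therefore not used.
\<close>
definition square :: "real^2 \<Rightarrow> real \<Rightarrow> (real^2) set" where
  "square a r = {y. infnorm (y - a) \<le> r}"

definition unit_square :: "(real^2) set" where
  "unit_square = {x. x $ 1 \<in> {-1..1} \<and> x $ 2 \<in> {-1..1}}"

text \<open>\<open>s Q\<^sub>0\<close>, being the whole plane for \<open>s = \<infinity>\<close>.\<close>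
definition dilated_unit_square :: "ennreal \<Rightarrow> (real^2) set" where
  "dilated_unit_square s =
     (if s = top then UNIV else (\<lambda>x. enn2real s *\<^sub>R x) ` unit_square)"

definition uniform_dist :: "real^2 \<Rightarrow> (real^2) set \<Rightarrow> real" where
  "uniform_dist a S = (INF y\<in>S. infnorm (y - a))"

definition metric_projection :: "real^2 \<Rightarrow> (real^2) set \<Rightarrow> (real^2) set" where
  "metric_projection a S = S \<inter> square a (uniform_dist a S)"

definition lip_seminorm ::
    "'a set \<Rightarrow> ('a \<Rightarrow> 'a \<Rightarrow> ennreal) \<Rightarrow> ('a \<Rightarrow> real^2) \<Rightarrow> ennreal" where
  "lip_seminorm M \<rho> f =
     Inf {ennreal l | l. 0 \<le> l \<and>
            (\<forall>x\<in>M. \<forall>y\<in>M. ennreal (infnorm (f x - f y)) \<le> scaled_dist l (\<rho> x y))}"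

definition lipschitz_selection ::
    "'a set \<Rightarrow> ('a \<Rightarrow> 'a \<Rightarrow> ennreal) \<Rightarrow> ('a \<Rightarrow> (real^2) set) \<Rightarrow> ('a \<Rightarrow> real^2) \<Rightarrow> bool" where
  "lipschitz_selection M \<rho> F f \<longleftrightarrow> (\<forall>x\<in>M. f x \<in> F x) \<and> lip_seminorm M \<rho> f < top"

definition rectangle :: "(real^2) set \<Rightarrow> bool" where
  "rectangle R \<longleftrightarrow>
     (\<exists>I\<^sub>1 I\<^sub>2 :: real set.
        is_interval I\<^sub>1 \<and> closed I\<^sub>1 \<and> I\<^sub>1 \<noteq> {} \<and>
        is_interval I\<^sub>2 \<and> closed I\<^sub>2 \<and> I\<^sub>2 \<noteq> {} \<and>
        R = {x. x $ 1 \<in> I\<^sub>1 \<and> x $ 2 \<in> I\<^sub>2})"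

text \<open>
  The rectangular hull of \<open>S\<close> is \<^term>\<open>rectangle hull S\<close>, the intersection of all rectangles
  containing \<open>S\<close>; for nonempty \<open>S\<close> it is itself a rectangle, hence the smallest one.
\<close>
lemma rectangle_rectangle_hull:
  assumes "S \<noteq> {}"
  shows "rectangle (rectangle hull S)"
proof -
  define J :: "2 \<Rightarrow> real set"
    where "J i = \<Inter>{I. is_interval I \<and> closed I \<and> (\<lambda>x. x $ i) ` S \<subseteq> I}" for i
  have J_interval: "is_interval (J i)" for i
    unfolding J_def is_interval_1 by blast
  have J_closed: "closed (J i)" for i
    unfolding J_def by (intro closed_Inter) auto
  have J_S: "(\<lambda>x. x $ i) ` S \<subseteq> J i" for i
    unfolding J_def by blast
  have J_nonempty: "J i \<noteq> {}" for i
    using J_S[of i] assms by auto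
  let ?R = "{x :: real^2. x $ 1 \<in> J 1 \<and> x $ 2 \<in> J 2}"
  have R: "rectangle ?R"
    unfolding rectangle_def using J_interval J_closed J_nonempty
    by (intro exI[of _ "J 1"] exI[of _ "J 2"] conjI refl)
  have "rectangle hull S = ?R"
  proof (rule hull_unique)
    show "S \<subseteq> ?R" using J_S by auto
    show "rectangle ?R" by (fact R)
  next
    fix T assume "S \<subseteq> T" "rectangle T"
    then obtain A B where "is_interval A" "closed A" "is_interval B" "closed B"
      and T: "T = {x. x $ 1 \<in> A \<and> x $ 2 \<in> B}"
      unfolding rectangle_def by blast
    moreover have "(\<lambda>x. x $ 1) ` S \<subseteq> A" "(\<lambda>x. x $ 2) ` S \<subseteq> B"
      using \<open>S \<subseteq> T\<close> T by auto
    ultimately have "J 1 \<subseteq> A" "J 2 \<subseteq> B"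
      unfolding J_def by (simp_all add: Inter_lower)
    then show "?R \<subseteq> T" unfolding T by (auto dest: subsetD)
  qed
  then show ?thesis using R by simp
qed

definition center_of_symmetry :: "real^2 \<Rightarrow> (real^2) set \<Rightarrow> bool" where
  "center_of_symmetry c S \<longleftrightarrow> S \<noteq> {} \<and> (\<lambda>x. 2 *\<^sub>R c - x) ` S = S"

text \<open>
  One refinement step, the paper's \<open>G\<close> with superscript \<open>[1]\<close> at \<open>x\<close> with constant \<open>l\<close>. The sum
  is the Minkowski sum of \<^theory>\<open>HOL-Library.Set_Algebras\<close>.
\<close>
definition refinement ::
    "'a set \<Rightarrow> ('a \<Rightarrow> 'a \<Rightarrow> ennreal) \<Rightarrow> ('a \<Rightarrow> (real^2) set) \<Rightarrow> real \<Rightarrow> 'a \<Rightarrow> (real^2) set" where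
  "refinement M \<rho> G l x = (\<Inter>y\<in>M. G y + dilated_unit_square (scaled_dist l (\<rho> x y)))"

definition hull_map ::
    "'a set \<Rightarrow> ('a \<Rightarrow> 'a \<Rightarrow> ennreal) \<Rightarrow> ('a \<Rightarrow> (real^2) set) \<Rightarrow> real \<Rightarrow> 'a \<Rightarrow> (real^2) set" where
  "hull_map M \<rho> F l\<^sub>1 x = rectangle hull (refinement M \<rho> F l\<^sub>1 x)"

definition hull_refinement ::
    "'a set \<Rightarrow> ('a \<Rightarrow> 'a \<Rightarrow> ennreal) \<Rightarrow> ('a \<Rightarrow> (real^2) set) \<Rightarrow> real \<Rightarrow> real \<Rightarrow> 'a \<Rightarrow> (real^2) set"
  where
  "hull_refinement M \<rho> F l\<^sub>1 l\<^sub>2 = refinement M \<rho> (hull_map M \<rho> F l\<^sub>1) l\<^sub>2"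

definition center_map ::
    "'a set \<Rightarrow> ('a \<Rightarrow> 'a \<Rightarrow> ennreal) \<Rightarrow> ('a \<Rightarrow> (real^2) set) \<Rightarrow> real \<Rightarrow> real \<Rightarrow> 'a \<Rightarrow> real^2" where
  "center_map M \<rho> F l\<^sub>1 l\<^sub>2 x =
     (THE c. center_of_symmetry c (metric_projection 0 (hull_refinement M \<rho> F l\<^sub>1 l\<^sub>2 x)))"

definition projection_map ::
    "'a set \<Rightarrow> ('a \<Rightarrow> 'a \<Rightarrow> ennreal) \<Rightarrow> ('a \<Rightarrow> (real^2) set) \<Rightarrow> real \<Rightarrow> real \<Rightarrow> 'a \<Rightarrow> real^2" where
  "projection_map M \<rho> F l\<^sub>1 l\<^sub>2 x =
     the_elem (metric_projection (center_map M \<rho> F l\<^sub>1 l\<^sub>2 x) (refinement M \<rho> F l\<^sub>1 x))"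

datatype 'a outcome = No_go | Success "'a \<Rightarrow> real^2"

definition projection_algorithm ::
    "'a set \<Rightarrow> ('a \<Rightarrow> 'a \<Rightarrow> ennreal) \<Rightarrow> ('a \<Rightarrow> (real^2) set) \<Rightarrow> real \<Rightarrow> real \<Rightarrow> 'a outcome" where
  "projection_algorithm M \<rho> F l\<^sub>1 l\<^sub>2 =
     (if \<exists>x\<in>M. refinement M \<rho> F l\<^sub>1 x = {} then No_go
      else if \<exists>x\<in>M. hull_refinement M \<rho> F l\<^sub>1 l\<^sub>2 x = {} then No_go
      else Success (projection_map M \<rho> F l\<^sub>1 l\<^sub>2))"

end

theory Submission
  imports Defs
begin

text \<open>
  Write \<open>A\<close> and \<open>B\<close> for the refinements of \<open>F\<close> at \<open>x\<close> and \<open>y\<close>, and \<open>a\<close> and \<open>b\<close> for the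
  centers at \<open>x\<close> and \<open>y\<close>. Helly's theorem in each coordinate puts the two refined rectangles
  within \<open>l\<^sub>2 \<rho>(x,y)\<close> of each other, and then so are their projections of the origin and the
  centers \<open>a\<close>, \<open>b\<close> of these.

  Since \<open>a\<close> lies in the rectangular hull of the convex set \<open>A\<close>, a line separating \<open>A\<close> from the
  largest open square around \<open>a\<close> disjoint from \<open>A\<close> is not parallel to an axis, so \<open>A\<close> touches
  the square in one corner \<open>p\<close>, which is the projection of \<open>a\<close>. In fact already one of the sets
  \<open>F(u) + l\<^sub>1 \<rho>(x,u) Q\<^sub>0\<close> whose intersection is \<open>A\<close> misses the open square; hence \<open>p\<close> has a
  supporting line of that single set, and \<open>B\<close> lies within \<open>l\<^sub>1 \<rho>(x,y)\<close> of its half-plane. The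
  supporting lines at \<open>p\<close> and at the corresponding corner \<open>q\<close> for \<open>B\<close> bound the difference of
  the sizes of the two squares, or their sum in a coordinate in which \<open>p\<close> and \<open>q\<close> are opposite
  corners, by \<open>(l\<^sub>1 + l\<^sub>2) \<rho>(x,y)\<close>. A coordinate of \<open>p - q\<close> exceeds that of \<open>a - b\<close> by at most
  this difference or sum.
\<close>

section \<open>Coordinates and rectangles in the plane\<close>

lemma infnorm_le_iff: "infnorm (x::real^2) \<le> r \<longleftrightarrow> (\<forall>k. \<bar>x $ k\<bar> \<le> r)"
  by (simp add: infnorm_2 forall_2)

lemma infnorm_less_iff: "infnorm (x::real^2) < r \<longleftrightarrow> (\<forall>k. \<bar>x $ k\<bar> < r)"
  by (simp add: infnorm_2 forall_2)

lemma inner_pair: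
  fixes x y :: "real^2"
  assumes "i \<noteq> j"
  shows "x \<bullet> y = x $ i * y $ i + x $ j * y $ j"
proof -
  have "(i = 1 \<and> j = 2) \<or> (i = 2 \<and> j = 1)"
    using assms exhaust_2[of i] exhaust_2[of j] by auto
  then show ?thesis by (auto simp: inner_vec_def sum_2)
qed

lemma index_pair: "i \<noteq> j \<Longrightarrow> k = i \<or> k = j" for i j k :: 2
  using exhaust_2[of i] exhaust_2[of j] exhaust_2[of k] by auto

lemma mem_is_interval_between:
  fixes S :: "(real^'n) set"
  assumes "is_interval S" "c \<in> S" "v \<in> S"
    and "\<And>k. (c $ k \<le> w $ k \<and> w $ k \<le> v $ k) \<or> (v $ k \<le> w $ k \<and> w $ k \<le> c $ k)"
  shows "w \<in> S"
  using assms unfolding is_interval_cart by blast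

text \<open>This form passes to intersections and can be tested by coordinatewise betweenness. For
  the converse, the two factors are read off from the axis-parallel slices through one fixed point
  \<open>e\<close>.\<close>

lemma rectangle_iff: "rectangle R \<longleftrightarrow> is_interval R \<and> closed R \<and> R \<noteq> {}"
proof (intro iffI conjI)
  assume "rectangle R"
  then obtain I J where IJ: "is_interval I" "closed I" "I \<noteq> {}" "is_interval J" "closed J" "J \<noteq> {}"
    and R: "R = {x. x $ 1 \<in> I \<and> x $ 2 \<in> J}"
    unfolding rectangle_def by blast
  show "is_interval R"
    using IJ(1,4) unfolding R is_interval_cart is_interval_1 forall_2 by blast
  have "R = (\<lambda>x. x $ 1) -` I \<inter> (\<lambda>x. x $ 2) -` J"
    by (auto simp: R)
  moreover have "closed ((\<lambda>x::real^2. x $ k) -` L)" if "closed L" for L and k :: 2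
    by (rule closed_vimage[OF that]) (intro continuous_intros)
  ultimately show "closed R"
    using IJ by (auto intro: closed_Int)
  obtain s t where "s \<in> I" "t \<in> J" using IJ by auto
  then have "vector [s, t] \<in> R" by (simp add: R)
  then show "R \<noteq> {}" by auto
next
  assume *: "is_interval R \<and> closed R \<and> R \<noteq> {}"
  then obtain e where e: "e \<in> R" by auto
  define slice where "slice k t = (\<chi> i. if i = k then t else e $ i)" for k :: 2 and t :: real
  define I where "I k = slice k -` R" for k
  have cont: "continuous_on UNIV (slice k)" for k
    unfolding slice_def
  proof (intro continuous_on_vec_lambda)
    show "continuous_on UNIV (\<lambda>t. if i = k then t else e $ i)" for i
      by (cases "i = k") auto
  qed
  have "closed (I k)" for k
    unfolding I_def using * cont by (intro closed_vimage) auto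
  moreover have "is_interval (I k)" for k
    unfolding is_interval_1 I_def
  proof (intro ballI allI impI)
    fix s t u assume "s \<in> slice k -` R" "t \<in> slice k -` R" "s \<le> u \<and> u \<le> t"
    then have st: "slice k s \<in> R" "slice k t \<in> R" "s \<le> u" "u \<le> t" by auto
    have "slice k u \<in> R"
      by (rule mem_is_interval_between[of R "slice k s" "slice k t"])
        (use * st in \<open>simp_all add: slice_def\<close>)
    then show "u \<in> slice k -` R" by simp
  qed
  moreover have "slice k (e $ k) = e" for k
    by (simp add: slice_def vec_eq_iff)
  then have "e $ k \<in> I k" for k
    by (simp add: I_def e)
  then have "I k \<noteq> {}" for k by auto
  moreover have "R = {x. x $ 1 \<in> I 1 \<and> x $ 2 \<in> I 2}"
  proof (intro set_eqI iffI)
    fix x :: "real^2" assume x: "x \<in> R"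
    have "slice k (x $ k) \<in> R" for k
    proof (rule mem_is_interval_between[of R x e])
      show "x $ i \<le> slice k (x $ k) $ i \<and> slice k (x $ k) $ i \<le> e $ i \<or>
         e $ i \<le> slice k (x $ k) $ i \<and> slice k (x $ k) $ i \<le> x $ i" for i
        by (cases "i = k") (auto simp: slice_def)
    qed (use * x e in auto)
    then show "x \<in> {x. x $ 1 \<in> I 1 \<and> x $ 2 \<in> I 2}"
      by (simp add: I_def)
  next
    fix x :: "real^2" assume "x \<in> {x. x $ 1 \<in> I 1 \<and> x $ 2 \<in> I 2}"
    then have "slice 1 (x $ 1) \<in> R" "slice 2 (x $ 2) \<in> R"
      by (auto simp: I_def)
    \<comment> \<open>The two slices have coordinates (x_1, e_2) and (e_1, x_2), so \<open>x\<close>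
      is a corner of the box that they span.\<close>
    moreover have "\<forall>k. slice 1 (x $ 1) $ k \<le> x $ k \<and> x $ k \<le> slice 2 (x $ 2) $ k \<or>
         slice 2 (x $ 2) $ k \<le> x $ k \<and> x $ k \<le> slice 1 (x $ 1) $ k"
      unfolding forall_2 by (simp add: slice_def linear)
    ultimately show "x \<in> R"
      using * mem_is_interval_between by blast
  qed
  ultimately show "rectangle R"
    unfolding rectangle_def by (intro exI[of _ "I 1"] exI[of _ "I 2"] conjI)
qed

section \<open>Minkowski sums with dilated squares\<close>

lemma mem_dilated_unit_square:
  "y \<in> dilated_unit_square s \<longleftrightarrow> ennreal (infnorm y) \<le> s"
proof (cases "s = top")
  case False
  then obtain t where t: "s = ennreal t" "t \<ge> 0" by (cases s) auto
  have "y \<in> (\<lambda>x. t *\<^sub>R x) ` unit_square \<longleftrightarrow> infnorm y \<le> t"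
  proof
    assume "y \<in> (\<lambda>x. t *\<^sub>R x) ` unit_square"
    then obtain x where "x \<in> unit_square" "y = t *\<^sub>R x" by auto
    moreover from this(1) have "infnorm x \<le> 1"
      by (simp add: unit_square_def infnorm_2 abs_le_iff)
    ultimately show "infnorm y \<le> t"
      using t(2) by (simp add: infnorm_mul mult_left_le)
  next
    assume y: "infnorm y \<le> t"
    show "y \<in> (\<lambda>x. t *\<^sub>R x) ` unit_square"
    proof (cases "t = 0")
      case True
      then have "y = 0" using y by (metis infnorm_eq_0 infnorm_pos_le order_antisym)
      then show ?thesis using True by (auto simp: unit_square_def image_iff intro!: exI[of _ 0])
    next
      case False
      then have "y = t *\<^sub>R ((1/t) *\<^sub>R y)" "(1/t) *\<^sub>R y \<in> unit_square"
        using y t(2) by (auto simp: unit_square_def infnorm_2 field_simps abs_le_iff)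
      then show ?thesis by blast
    qed
  qed
  then show ?thesis
    using t by (simp add: dilated_unit_square_def)
qed (simp add: dilated_unit_square_def)

lemma mem_plus_dilated:
  "x \<in> G + dilated_unit_square s \<longleftrightarrow> (\<exists>z\<in>G. ennreal (infnorm (x - z)) \<le> s)"
proof
  assume "x \<in> G + dilated_unit_square s"
  then obtain z y where "z \<in> G" "ennreal (infnorm y) \<le> s" "x = z + y"
    by (auto simp: set_plus_def mem_dilated_unit_square)
  then show "\<exists>z\<in>G. ennreal (infnorm (x - z)) \<le> s"
    by (intro bexI[of _ z]) simp_all
next
  assume "\<exists>z\<in>G. ennreal (infnorm (x - z)) \<le> s"
  then obtain z where "z \<in> G" "x - z \<in> dilated_unit_square s"
    by (auto simp: mem_dilated_unit_square)
  then have "z + (x - z) \<in> G + dilated_unit_square s" by (rule set_plus_intro)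
  then show "x \<in> G + dilated_unit_square s" by simp
qed

lemma mem_refinement:
  "x' \<in> refinement M \<rho> G l x \<longleftrightarrow>
     (\<forall>y\<in>M. \<exists>z\<in>G y. ennreal (infnorm (x' - z)) \<le> scaled_dist l (\<rho> x y))"
  by (simp add: refinement_def mem_plus_dilated)

lemma scaled_dist_finite:
  "0 \<le> l \<Longrightarrow> r \<noteq> top \<Longrightarrow> scaled_dist l r = ennreal (l * enn2real r)"
  by (cases r) (auto simp: scaled_dist_def ennreal_mult)

lemma dilated_unit_square_cbox:
  "0 \<le> t \<Longrightarrow> dilated_unit_square (ennreal t) = cbox (vec (-t)) (vec t)"
  by (auto simp: mem_dilated_unit_square mem_box_cart infnorm_le_iff abs_le_iff minus_le_iff)

lemma convex_dilated_unit_square: "convex (dilated_unit_square s)"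
  by (cases s) (auto simp: dilated_unit_square_cbox dilated_unit_square_def[of top])

text \<open>For finite \<open>s\<close> this is closed plus compact. For infinite \<open>s\<close>
  the second summand is not compact, but the sum is then empty or the whole plane.\<close>

lemma closed_plus_dilated:
  assumes "closed G"
  shows "closed (G + dilated_unit_square s)"
proof (cases s)
  case (real t)
  have "closed (\<Union>x\<in>G. \<Union>y\<in>dilated_unit_square s. {x + y})"
    by (rule closed_compact_sums[OF assms]) (simp add: real dilated_unit_square_cbox)
  moreover have "(\<Union>x\<in>G. \<Union>y\<in>dilated_unit_square s. {x + y}) = G + dilated_unit_square s"
    by (auto simp: set_plus_def)
  ultimately show ?thesis by simp
next
  case top
  have "G + UNIV = {} \<or> G + UNIV = UNIV"
    using mem_plus_dilated[of _ G top] by (auto simp: dilated_unit_square_def)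
  then show ?thesis by (auto simp: dilated_unit_square_def top)
qed

lemma is_interval_plus_dilated:
  assumes "is_interval G"
  shows "is_interval (G + dilated_unit_square s)"
  unfolding is_interval_cart
proof (intro ballI allI impI)
  fix x y w :: "real^2"
  assume "x \<in> G + dilated_unit_square s" "y \<in> G + dilated_unit_square s"
    and w: "\<forall>i. x $ i \<le> w $ i \<and> w $ i \<le> y $ i \<or> y $ i \<le> w $ i \<and> w $ i \<le> x $ i"
  then obtain g h where gh: "g \<in> G" "ennreal (infnorm (x - g)) \<le> s"
      "h \<in> G" "ennreal (infnorm (y - h)) \<le> s"
    by (auto simp: mem_plus_dilated)
  \<comment> \<open>\<open>v\<close> clamps \<open>w\<close> to the box spanned by \<open>g\<close>
    and \<open>h\<close>. In each coordinate \<open>w\<close> lies between \<open>x\<close> and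
    \<open>y\<close>, so it overshoots this box by no more than \<open>x\<close> is away from
    \<open>g\<close> or \<open>y\<close> from \<open>h\<close>.\<close>
  define v where "v = (\<chi> i. max (min (g $ i) (h $ i)) (min (max (g $ i) (h $ i)) (w $ i)))"
  have "v \<in> G"
    by (rule mem_is_interval_between[OF assms gh(1,3)]) (auto simp: v_def)
  moreover have "infnorm (w - v) \<le> max (infnorm (x - g)) (infnorm (y - h))"
    unfolding infnorm_le_iff
  proof
    fix k
    have "\<bar>(x - g) $ k\<bar> \<le> infnorm (x - g)" "\<bar>(y - h) $ k\<bar> \<le> infnorm (y - h)"
      using infnorm_le_iff by blast+
    then show "\<bar>(w - v) $ k\<bar> \<le> max (infnorm (x - g)) (infnorm (y - h))"
      using w[rule_format, of k] by (simp add: v_def) argo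
  qed
  then have "ennreal (infnorm (w - v)) \<le> s"
    using gh(2,4) ennreal_leI order_trans by (metis max_def)
  ultimately show "w \<in> G + dilated_unit_square s"
    by (auto simp: mem_plus_dilated)
qed

text \<open>One direction of "Hausdorff distance at most \<open>\<delta>\<close>" in the uniform
  norm, with the nearby point attained.\<close>

definition close_within :: "real \<Rightarrow> (real^2) set \<Rightarrow> (real^2) set \<Rightarrow> bool" where
  "close_within \<delta> A B \<longleftrightarrow> (\<forall>z\<in>A. \<exists>w\<in>B. infnorm (z - w) \<le> \<delta>)"

text \<open>A point \<open>z\<close> outside the neighbourhood of radius \<open>\<alpha>\<close> is
  pulled back along the segment to its partner \<open>v\<close> in \<open>G\<close> until its
  distance from \<open>v\<close> is \<open>\<alpha>\<close>. By the triangle inequality for the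
  radii it moves by at most \<open>\<beta>\<close>. In the application \<open>r\<close>,
  \<open>t\<close>, \<open>t'\<close> are the distances between \<open>x\<close> and
  \<open>y\<close>, \<open>x\<close> and \<open>u\<close>, \<open>y\<close> and
  \<open>u\<close>.\<close>

lemma close_within_plus_dilated:
  assumes "0 \<le> l" "r \<noteq> top" "t \<le> r + t'"
  shows "close_within (l * enn2real r)
    (G + dilated_unit_square (scaled_dist l t)) (G + dilated_unit_square (scaled_dist l t'))"
  unfolding close_within_def
proof
  fix z assume "z \<in> G + dilated_unit_square (scaled_dist l t)"
  then obtain v where v: "v \<in> G" "ennreal (infnorm (z - v)) \<le> scaled_dist l t"
    by (auto simp: mem_plus_dilated)
  define \<alpha> \<beta> d where "\<alpha> = l * enn2real t'" and "\<beta> = l * enn2real r" and "d = infnorm (z - v)"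
  have pos: "0 \<le> \<alpha>" "0 \<le> \<beta>" using assms by (auto simp: \<alpha>_def \<beta>_def)
  show "\<exists>w\<in>G + dilated_unit_square (scaled_dist l t'). infnorm (z - w) \<le> l * enn2real r"
  proof (cases "t' = top \<or> d \<le> \<alpha>")
    case True
    then have "ennreal (infnorm (z - v)) \<le> scaled_dist l t'"
      using assms(1) by (cases "t' = top") (auto simp: scaled_dist_def[of _ top] scaled_dist_finite d_def \<alpha>_def)
    then show ?thesis
      using v(1) pos(2) unfolding mem_plus_dilated
      by (intro bexI[of _ z]) (auto simp: mem_plus_dilated \<beta>_def infnorm_0)
  next
    case False
    then have fin: "t' \<noteq> top" "t \<noteq> top" and d: "\<alpha> < d"
      using assms(2,3) by (auto simp: top_unique)
    have "enn2real t \<le> enn2real r + enn2real t'"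
      using assms(2,3) fin(1) by (metis enn2real_mono enn2real_plus ennreal_add_eq_top less_top)
    then have "l * enn2real t \<le> \<alpha> + \<beta>"
      using assms(1) by (metis \<alpha>_def \<beta>_def add.commute distrib_left mult_left_mono)
    moreover have "d \<le> l * enn2real t"
      using v(2) assms(1) fin by (simp add: scaled_dist_finite d_def)
    ultimately have d2: "d \<le> \<alpha> + \<beta>" by simp
    have d0: "0 < d" using d pos by linarith
    define w where "w = v + (\<alpha> / d) *\<^sub>R (z - v)"
    have "infnorm (w - v) = \<alpha>"
      using d0 pos by (simp add: w_def infnorm_mul d_def[symmetric])
    then have "w \<in> G + dilated_unit_square (scaled_dist l t')"
      using v(1) assms(1) fin unfolding mem_plus_dilated
      by (intro bexI[of _ v]) (simp_all add: scaled_dist_finite \<alpha>_def)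
    moreover have "z - w = (1 - \<alpha> / d) *\<^sub>R (z - v)"
      by (simp add: w_def algebra_simps)
    then have "infnorm (z - w) = (1 - \<alpha> / d) * d"
      using d d0 by (simp add: infnorm_mul d_def[symmetric])
    then have "infnorm (z - w) = d - \<alpha>"
      using d0 by (simp add: left_diff_distrib)
    then have "infnorm (z - w) \<le> \<beta>"
      using d2 by simp
    ultimately show ?thesis by (auto simp: \<beta>_def)
  qed
qed

section \<open>The Lipschitz seminorm\<close>

text \<open>A finite infimum is attained: for a pair at finite distance the constraint is closed in
  the constant, and a pair at infinite distance imposes none.\<close>

lemma lip_seminorm_le_iff:
  assumes "0 \<le> L"
  shows "lip_seminorm M \<rho> f \<le> ennreal L \<longleftrightarrow>
    (\<forall>x\<in>M. \<forall>y\<in>M. ennreal (infnorm (f x - f y)) \<le> scaled_dist L (\<rho> x y))"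
proof
  assume "\<forall>x\<in>M. \<forall>y\<in>M. ennreal (infnorm (f x - f y)) \<le> scaled_dist L (\<rho> x y)"
  then show "lip_seminorm M \<rho> f \<le> ennreal L"
    unfolding lip_seminorm_def using assms by (intro Inf_lower) auto
next
  assume le: "lip_seminorm M \<rho> f \<le> ennreal L"
  show "\<forall>x\<in>M. \<forall>y\<in>M. ennreal (infnorm (f x - f y)) \<le> scaled_dist L (\<rho> x y)"
  proof (intro ballI)
    fix x y assume xy: "x \<in> M" "y \<in> M"
    show "ennreal (infnorm (f x - f y)) \<le> scaled_dist L (\<rho> x y)"
    proof (cases "\<rho> x y = top")
      case False
      define R where "R = enn2real (\<rho> x y)"
      have "R \<ge> 0" by (simp add: R_def)
      have "infnorm (f x - f y) \<le> (L + e) * R" if "e > 0" for e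
      proof -
        have "lip_seminorm M \<rho> f < ennreal (L + e)"
          using le assms that by (metis add_less_cancel_left add.right_neutral ennreal_lessI le_less_trans
              add_nonneg_pos)
        then obtain l where l: "0 \<le> l" "ennreal l < ennreal (L + e)"
          and f: "ennreal (infnorm (f x - f y)) \<le> scaled_dist l (\<rho> x y)"
          unfolding lip_seminorm_def Inf_less_iff using xy by auto
        have "infnorm (f x - f y) \<le> l * R"
          using f l False by (simp add: scaled_dist_finite R_def)
        also have "\<dots> \<le> (L + e) * R"
          using l \<open>R \<ge> 0\<close> by (intro mult_right_mono) (auto simp: ennreal_less_iff)
        finally show ?thesis .
      qed
      then have *: "infnorm (f x - f y) \<le> L * R + e * R" if "e > 0" for e
        using that by (metis distrib_right)
      have "infnorm (f x - f y) \<le> L * R + e" if "e > 0" for e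
      proof -
        \<comment> \<open>Dividing by \<open>R + 1\<close> instead of \<open>R\<close> covers the
          case \<open>R = 0\<close>.\<close>
        have "e / (R + 1) * R \<le> e" using that \<open>R \<ge> 0\<close> by (simp add: field_simps)
        then show ?thesis
          using *[of "e / (R + 1)"] that \<open>R \<ge> 0\<close> by auto
      qed
      then have "infnorm (f x - f y) \<le> L * R"
        by (rule field_le_epsilon)
      then show ?thesis
        using assms False by (simp add: scaled_dist_finite R_def)
    qed (simp add: scaled_dist_def)
  qed
qed

section \<open>Uniform distance and metric projection\<close>

lemma uniform_dist_lower: "p \<in> S \<Longrightarrow> uniform_dist a S \<le> infnorm (p - a)"
  unfolding uniform_dist_def
  by (rule cINF_lower) (auto intro!: bdd_belowI[of _ 0] infnorm_pos_le)

lemma square_cbox: "square a r = cbox (a - vec r) (a + vec r)"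
  by (auto simp: square_def mem_box_cart infnorm_le_iff abs_le_iff algebra_simps)

lemma uniform_dist_attained:
  assumes "closed S" "S \<noteq> {}"
  obtains p where "p \<in> S" "infnorm (p - a) = uniform_dist a S"
proof -
  obtain s where s: "s \<in> S" using assms by auto
  \<comment> \<open>Only points no farther from \<open>a\<close> than \<open>s\<close> compete for
    the minimum, and they form a compact set even if \<open>S\<close> is unbounded.\<close>
  let ?K = "S \<inter> square a (infnorm (s - a))"
  have "compact ?K"
    using assms(1) by (simp add: square_cbox closed_Int_compact)
  moreover have "s \<in> ?K" using s by (simp add: square_def)
  moreover have "continuous_on ?K (\<lambda>y. infnorm (y - a))"
    by (intro continuous_on_infnorm continuous_on_diff continuous_on_id continuous_on_const)
  ultimately obtain p where p: "p \<in> ?K" "\<And>y. y \<in> ?K \<Longrightarrow> infnorm (p - a) \<le> infnorm (y - a)"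
    using continuous_attains_inf[of ?K "\<lambda>y. infnorm (y - a)"] by blast
  have "infnorm (p - a) \<le> infnorm (y - a)" if "y \<in> S" for y
  proof (cases "y \<in> ?K")
    case False
    then have "infnorm (s - a) < infnorm (y - a)" using that by (auto simp: square_def)
    then show ?thesis using p(1) by (simp add: square_def)
  qed (use p in auto)
  then have "infnorm (p - a) \<le> uniform_dist a S"
    unfolding uniform_dist_def using assms(2) by (intro cINF_greatest) auto
  with p(1) uniform_dist_lower[of p S a] that show thesis by force
qed

lemma metric_projection_nonempty:
  assumes "closed S" "S \<noteq> {}"
  shows "metric_projection a S \<noteq> {}"
  using uniform_dist_attained[OF assms, of a]
  by (metis (no_types, lifting) IntI empty_iff mem_Collect_eq metric_projection_def order_refl square_def)

lemma mem_metric_projection: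
  "p \<in> metric_projection a S \<longleftrightarrow> p \<in> S \<and> infnorm (p - a) = uniform_dist a S"
  unfolding metric_projection_def square_def using uniform_dist_lower[of p S a] by auto

lemma uniform_dist_nonneg: "S \<noteq> {} \<Longrightarrow> 0 \<le> uniform_dist a S"
  unfolding uniform_dist_def by (intro cINF_greatest) (auto intro: infnorm_pos_le)

section \<open>Stability of projections and centers for nearby rectangles\<close>

lemma uniform_dist_close_within:
  assumes "close_within \<delta> A B" "closed A" "A \<noteq> {}"
  shows "uniform_dist a B \<le> uniform_dist a A + \<delta>"
proof -
  obtain p where p: "p \<in> A" "infnorm (p - a) = uniform_dist a A"
    using uniform_dist_attained[OF assms(2,3)] .
  then obtain w where w: "w \<in> B" "infnorm (p - w) \<le> \<delta>"
    using assms(1) by (auto simp: close_within_def)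
  have "uniform_dist a B \<le> infnorm ((p - a) + (w - p))"
    using uniform_dist_lower[OF w(1), of a] by simp
  also have "\<dots> \<le> uniform_dist a A + \<delta>"
    using infnorm_triangle[of "p - a" "w - p"] w(2) p(2) by (simp add: infnorm_sub)
  finally show ?thesis .
qed

text \<open>The distance from \<open>a\<close> to \<open>A\<close> exceeds that to \<open>B\<close>
  by at most \<open>\<delta>\<close>. Hence a point \<open>v\<close> of \<open>B\<close> near
  \<open>z\<close> can be clamped into the square of radius \<open>s\<close> around \<open>a\<close>
  and stays near \<open>z\<close>. Clamping moves \<open>v\<close> towards a nearest point
  \<open>u\<close> in each coordinate, so the result remains in \<open>B\<close>.\<close>

lemma close_within_projection:
  assumes "close_within \<delta> A B" "close_within \<delta> B A" "rectangle A" "rectangle B"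
  shows "close_within \<delta> (metric_projection a A) (metric_projection a B)"
  unfolding close_within_def
proof
  fix z assume z: "z \<in> metric_projection a A"
  note A = assms(3)[unfolded rectangle_iff] and B = assms(4)[unfolded rectangle_iff]
  define s where "s = uniform_dist a B"
  have s: "uniform_dist a A \<le> s + \<delta>"
    unfolding s_def using uniform_dist_close_within[OF assms(2)] B by auto
  obtain v where v: "v \<in> B" "infnorm (z - v) \<le> \<delta>"
    using assms(1) z by (auto simp: close_within_def mem_metric_projection)
  obtain u where u: "u \<in> B" "infnorm (u - a) = s"
    unfolding s_def using uniform_dist_attained B by metis
  define w where "w = (\<chi> i. max (a $ i - s) (min (a $ i + s) (v $ i)))"
  have "infnorm (z - a) \<le> s + \<delta>"
    using z s by (simp add: mem_metric_projection)
  then have bounds: "\<bar>z $ k - a $ k\<bar> \<le> s + \<delta>" "\<bar>z $ k - v $ k\<bar> \<le> \<delta>" "\<bar>u $ k - a $ k\<bar> \<le> s" for k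
    using v(2) u(2) infnorm_le_iff[of "z - a"] infnorm_le_iff[of "z - v"] infnorm_le_iff[of "u - a" s]
    by auto
  have "w \<in> B"
  proof (rule mem_is_interval_between[of B u v])
    show "u $ k \<le> w $ k \<and> w $ k \<le> v $ k \<or> v $ k \<le> w $ k \<and> w $ k \<le> u $ k" for k
      using bounds(3)[of k] by (simp add: w_def) argo
  qed (use B u v in auto)
  moreover have "infnorm (w - a) \<le> s"
    unfolding infnorm_le_iff
  proof
    show "\<bar>(w - a) $ k\<bar> \<le> s" for k
      using bounds(3)[of k] by (simp add: w_def)
  qed
  ultimately have "w \<in> metric_projection a B"
    by (simp add: metric_projection_def square_def s_def)
  moreover have "infnorm (z - w) \<le> \<delta>"
    unfolding infnorm_le_iff
  proof
    show "\<bar>(z - w) $ k\<bar> \<le> \<delta>" for k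
      using bounds[of k] by (simp add: w_def)
  qed
  ultimately show "\<exists>w\<in>metric_projection a B. infnorm (z - w) \<le> \<delta>" by blast
qed

lemma center_of_symmetry_cbox:
  fixes c d :: "real^2"
  assumes "cbox c d \<noteq> {}"
  shows "center_of_symmetry e (cbox c d) \<longleftrightarrow> e = (1/2) *\<^sub>R (c + d)"
proof
  assume e: "center_of_symmetry e (cbox c d)"
  have le: "c $ k \<le> d $ k" for k
    using assms by (metis interval_ne_empty_cart(1))
  then have "c \<in> cbox c d" "d \<in> cbox c d" by (auto simp: mem_box_cart)
  then have "2 *\<^sub>R e - c \<in> cbox c d" "2 *\<^sub>R e - d \<in> cbox c d"
    using e unfolding center_of_symmetry_def by blast+
  then have "2 * e $ k \<le> c $ k + d $ k" "c $ k + d $ k \<le> 2 * e $ k" for k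
    by (auto simp: mem_box_cart algebra_simps)
  then have "e $ k = (c $ k + d $ k) / 2" for k
    by (metis nonzero_mult_div_cancel_left order_antisym zero_neq_numeral)
  then show "e = (1/2) *\<^sub>R (c + d)"
    by (simp add: vec_eq_iff)
next
  assume e: "e = (1/2) *\<^sub>R (c + d)"
  have "2 *\<^sub>R e - x \<in> cbox c d" if "x \<in> cbox c d" for x
    using that by (simp add: mem_box_cart e)
  then have "(\<lambda>x. 2 *\<^sub>R e - x) ` cbox c d = cbox c d"
    by (force intro: image_eqI[of x _ "2 *\<^sub>R e - x" for x])
  then show "center_of_symmetry e (cbox c d)"
    using assms by (simp add: center_of_symmetry_def)
qed

text \<open>The projecting square is bounded, so the projection has two opposite corners, and with
  them a unique center, even if \<open>R\<close> is unbounded.\<close>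

lemma rectangle_projection_cbox:
  assumes "rectangle R"
  obtains c d where "metric_projection a R = cbox c d" "cbox c d \<noteq> {}"
proof -
  note R = assms[unfolded rectangle_iff]
  have "is_interval (metric_projection a R)" "compact (metric_projection a R)"
    unfolding metric_projection_def square_cbox using R
    by (auto intro: is_interval_Int closed_Int_compact)
  then obtain c d where "metric_projection a R = cbox c d"
    using is_interval_compact by blast
  with that metric_projection_nonempty R show thesis by metis
qed

lemma ex1_center_of_symmetry:
  assumes "rectangle R"
  shows "\<exists>!c. center_of_symmetry c (metric_projection a R)"
  using rectangle_projection_cbox[OF assms, of a] center_of_symmetry_cbox by metis

lemma center_of_symmetry_mem:
  assumes "rectangle R" "center_of_symmetry e (metric_projection a R)"
  shows "e \<in> R"
proof -
  obtain c d where cd: "metric_projection a R = cbox c d" "cbox c d \<noteq> {}"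
    using rectangle_projection_cbox[OF assms(1)] .
  have "c $ k \<le> d $ k" for k
    using cd(2) by (metis interval_ne_empty_cart(1))
  then have "e \<in> cbox c d"
    using assms(2) cd by (simp add: center_of_symmetry_cbox mem_box_cart field_simps)
  then show ?thesis
    using cd(1) by (auto simp: metric_projection_def)
qed

text \<open>The extreme values of each coordinate on the two projections differ by at most
  \<open>\<delta>\<close>, and the centers are the midpoints of these values.\<close>

lemma center_of_symmetry_close_within:
  assumes "close_within \<delta> A B" "close_within \<delta> B A" "rectangle A" "rectangle B"
    and "center_of_symmetry e (metric_projection a A)" "center_of_symmetry f (metric_projection a B)"
  shows "infnorm (e - f) \<le> \<delta>"
proof -
  have bound: "c' $ k \<le> c $ k + \<delta> \<and> d $ k \<le> d' $ k + \<delta>"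
    if close: "close_within \<delta> (cbox c d) (cbox c' d')" and ne: "cbox c d \<noteq> {}" for c d c' d' :: "real^2" and k
  proof -
    have "c \<in> cbox c d" "d \<in> cbox c d"
      using ne interval_ne_empty_cart(1)[of c d] by (auto simp: mem_box_cart)
    then obtain u v where "u \<in> cbox c' d'" "infnorm (c - u) \<le> \<delta>" "v \<in> cbox c' d'" "infnorm (d - v) \<le> \<delta>"
      using close unfolding close_within_def by meson
    then have "c' $ k \<le> u $ k" "\<bar>c $ k - u $ k\<bar> \<le> \<delta>" "v $ k \<le> d' $ k" "\<bar>d $ k - v $ k\<bar> \<le> \<delta>"
      by (auto simp: mem_box_cart infnorm_le_iff)
    then show ?thesis by linarith
  qed
  obtain c d c' d' where cd: "metric_projection a A = cbox c d" "cbox c d \<noteq> {}"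
      "metric_projection a B = cbox c' d'" "cbox c' d' \<noteq> {}"
    using rectangle_projection_cbox[OF assms(3)] rectangle_projection_cbox[OF assms(4)] by metis
  have ef: "e = (1/2) *\<^sub>R (c + d)" "f = (1/2) *\<^sub>R (c' + d')"
    using assms(5,6) cd by (simp_all add: center_of_symmetry_cbox)
  have "close_within \<delta> (cbox c d) (cbox c' d')" "close_within \<delta> (cbox c' d') (cbox c d)"
    using close_within_projection[of \<delta> A B a] close_within_projection[of \<delta> B A a] assms cd by auto
  note this[THEN bound]
  then have "c' $ k \<le> c $ k + \<delta> \<and> d $ k \<le> d' $ k + \<delta>" "c $ k \<le> c' $ k + \<delta> \<and> d' $ k \<le> d $ k + \<delta>" for k
    using cd by auto
  then have "\<bar>(e - f) $ k\<bar> \<le> \<delta>" for k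
    unfolding ef abs_le_iff by (simp add: field_simps) (smt (verit))
  then show ?thesis by (simp add: infnorm_le_iff)
qed

text \<open>One-dimensional Helly, carried out coordinatewise by clamping a common point towards \<open>z\<close>.\<close>
lemma close_within_Inter:
  assumes "\<And>u. u \<in> M \<Longrightarrow> close_within \<delta> (A u) (B u)"
    and "\<And>u. u \<in> M \<Longrightarrow> is_interval (B u)"
    and "c \<in> (\<Inter>u\<in>M. B u)" "0 \<le> \<delta>"
  shows "close_within \<delta> (\<Inter>u\<in>M. A u) (\<Inter>u\<in>M. B u)"
  unfolding close_within_def
proof
  fix z assume z: "z \<in> (\<Inter>u\<in>M. A u)"
  define w where "w = (\<chi> i. max (z $ i - \<delta>) (min (z $ i + \<delta>) (c $ i)))"
  have "w \<in> B u" if u: "u \<in> M" for u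
  proof -
    obtain v where v: "v \<in> B u" "infnorm (z - v) \<le> \<delta>"
      using assms(1)[OF u] z u by (auto simp: close_within_def)
    show ?thesis
    proof (rule mem_is_interval_between[of _ c v])
      fix k
      have "\<bar>z $ k - v $ k\<bar> \<le> \<delta>" using v(2) by (simp add: infnorm_le_iff)
      then show "c $ k \<le> w $ k \<and> w $ k \<le> v $ k \<or> v $ k \<le> w $ k \<and> w $ k \<le> c $ k"
        by (simp add: w_def) argo
    qed (use assms u v in auto)
  qed
  moreover have "\<bar>(z - w) $ k\<bar> \<le> \<delta>" for k
    using assms(4) by (simp add: w_def)
  then have "infnorm (z - w) \<le> \<delta>" by (simp add: infnorm_le_iff)
  ultimately show "\<exists>w\<in>\<Inter> (B ` M). infnorm (z - w) \<le> \<delta>" by blast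
qed

section \<open>Supporting lines at the corner of a square\<close>

text \<open>The half-plane given by the inequality is itself a rectangle containing
  \<open>A\<close>, so it contains the hull. The sign of \<open>c\<close> is free, which covers
  upper bounds as well.\<close>

lemma rectangle_hull_lower:
  fixes c t :: real
  assumes "a \<in> rectangle hull A" "A \<noteq> {}" "\<And>x. x \<in> A \<Longrightarrow> t \<le> c * x $ k"
  shows "t \<le> c * a $ k"
proof -
  let ?H = "{x :: real^2. t \<le> c * x $ k}"
  have "is_interval ?H"
    unfolding is_interval_cart
  proof (intro ballI allI impI)
    fix x y z :: "real^2" assume xy: "x \<in> ?H" "y \<in> ?H"
      and *: "\<forall>i. x $ i \<le> z $ i \<and> z $ i \<le> y $ i \<or> y $ i \<le> z $ i \<and> z $ i \<le> x $ i"
    from * have le: "x $ k \<le> z $ k \<or> y $ k \<le> z $ k" "z $ k \<le> x $ k \<or> z $ k \<le> y $ k"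
      by blast+
    have "c * x $ k \<le> c * z $ k \<or> c * y $ k \<le> c * z $ k"
      using le mult_left_mono mult_left_mono_neg by (metis linear)
    with xy show "z \<in> ?H" by auto
  qed
  moreover have "closed ?H"
    by (intro closed_Collect_le continuous_intros)
  ultimately have "rectangle ?H" "A \<subseteq> ?H"
    using assms(2,3) by (auto simp: rectangle_iff)
  then have "rectangle hull A \<subseteq> ?H"
    by (intro hull_minimal)
  then show ?thesis using assms(1) by auto
qed

lemma mult_sgn_self: "x * sgn x = \<bar>x\<bar>" for x :: real
  by (simp add: abs_sgn mult.commute)

text \<open>One line separates \<open>C\<close> from the open square of radius \<open>r\<close>
  around \<open>a\<close>. A point of \<open>C\<close> in the closed square lies on this line and so
  maximizes \<open>n\<close> over the square, which fixes each of its coordinates in which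
  \<open>n\<close> does not vanish.\<close>

lemma separating_normal_square:
  fixes C :: "(real^2) set"
  assumes "convex C" "C \<noteq> {}" "0 < r" "\<And>x. x \<in> C \<Longrightarrow> r \<le> infnorm (x - a)"
  obtains n where "n \<noteq> 0"
    and "\<And>p x. p \<in> C \<Longrightarrow> infnorm (p - a) \<le> r \<Longrightarrow> x \<in> C \<Longrightarrow> 0 \<le> n \<bullet> (x - p)"
    and "\<And>p k. p \<in> C \<Longrightarrow> infnorm (p - a) \<le> r \<Longrightarrow> n $ k * (p $ k - a $ k) = r * \<bar>n $ k\<bar>"
proof -
  let ?Q = "box (a - vec r) (a + vec r)"
  have a: "a \<in> ?Q" using assms(3) by (simp add: mem_box_cart)
  have "infnorm (x - a) < r" if "x \<in> ?Q" for x
    using that by (auto simp: infnorm_less_iff mem_box_cart abs_less_iff algebra_simps)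
  then have "?Q \<inter> C = {}"
    using assms(4) by force
  then obtain n c where n: "n \<noteq> 0" "\<forall>x\<in>?Q. n \<bullet> x \<le> c" "\<forall>x\<in>C. c \<le> n \<bullet> x"
    using separating_hyperplane_sets[of ?Q C] assms(1,2) a convex_box by (metis empty_iff)
  have "closure ?Q \<subseteq> {x. n \<bullet> x \<le> c}"
    using n(2) by (intro closure_minimal closed_halfspace_le) auto
  then have Q: "n \<bullet> x \<le> c" if "infnorm (x - a) \<le> r" for x
    using that a by (subst (asm) closure_box) (auto simp: square_cbox[symmetric] square_def)
  \<comment> \<open>A maximizer of \<open>n\<close> over the closed square; where \<open>n\<close>
    vanishes, \<open>sgn\<close> is 0 and the coordinate stays that of \<open>a\<close>.\<close>
  define e where "e = (\<chi> k. a $ k + r * sgn (n $ k))"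
  have "n \<bullet> e \<le> c"
    by (rule Q) (use assms(3) in \<open>simp add: infnorm_le_iff e_def abs_mult abs_sgn_eq\<close>)
  moreover have "n \<bullet> e = n \<bullet> a + r * (\<bar>n $ 1\<bar> + \<bar>n $ 2\<bar>)"
    by (simp add: inner_vec_def sum_2 e_def algebra_simps abs_sgn)
  ultimately have e: "n \<bullet> a + r * (\<bar>n $ 1\<bar> + \<bar>n $ 2\<bar>) \<le> c" by simp
  have eq: "n $ k * (p $ k - a $ k) = r * \<bar>n $ k\<bar>" if p: "p \<in> C" "infnorm (p - a) \<le> r" for p k
  proof -
    have le: "n $ k * (p $ k - a $ k) \<le> r * \<bar>n $ k\<bar>" for k
    proof -
      have "\<bar>p $ k - a $ k\<bar> \<le> r" using p(2) by (simp add: infnorm_le_iff)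
      then have "\<bar>n $ k * (p $ k - a $ k)\<bar> \<le> \<bar>n $ k\<bar> * r"
        unfolding abs_mult by (intro mult_left_mono) auto
      then show ?thesis by (simp add: mult.commute)
    qed
    have "c \<le> n \<bullet> p" using n(3) p by auto
    \<comment> \<open>Each summand on the right is at most the corresponding one on the left, so
      both are equal.\<close>
    then have "r * \<bar>n $ 1\<bar> + r * \<bar>n $ 2\<bar> \<le> n $ 1 * (p $ 1 - a $ 1) + n $ 2 * (p $ 2 - a $ 2)"
      using e by (simp add: inner_vec_def sum_2 algebra_simps)
    then show ?thesis
      using le[of 1] le[of 2] exhaust_2[of k] by auto
  qed
  have ge: "0 \<le> n \<bullet> (x - p)" if "p \<in> C" "infnorm (p - a) \<le> r" "x \<in> C" for p x
    using Q[OF that(2)] n(3) that(3) by (auto simp: inner_diff_right)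
  show thesis
    by (rule that[OF n(1) ge eq])
qed

text \<open>A normal parallel to an axis would push \<open>a\<close> out of the rectangular hull.\<close>
lemma hull_normal_nonzero:
  assumes "a \<in> rectangle hull A" "n \<noteq> 0" "p \<in> A" "0 < r"
    and "\<And>x. x \<in> A \<Longrightarrow> 0 \<le> n \<bullet> (x - p)"
    and "\<And>k. n $ k * (p $ k - a $ k) = r * \<bar>n $ k\<bar>"
  shows "n $ i \<noteq> 0" and "p $ i = a $ i + r * sgn (n $ i)"
proof -
  have nz: "n $ i \<noteq> 0" for i :: 2
  proof
    assume i: "n $ i = 0"
    obtain j where j: "n $ j \<noteq> 0"
      using assms(2) by (auto simp: vec_eq_iff)
    with i have ij: "i \<noteq> j" by auto
    have "n $ j * p $ j \<le> n $ j * x $ j" if "x \<in> A" for x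
      using assms(5)[OF that] i by (simp add: inner_pair[OF ij] algebra_simps)
    with assms(1,3) have "n $ j * p $ j \<le> n $ j * a $ j"
      using rectangle_hull_lower by blast
    moreover have "0 < n $ j * (p $ j - a $ j)"
      using assms(4,6) j by simp
    ultimately show False by (simp add: algebra_simps)
  qed
  show "n $ i \<noteq> 0" by (rule nz)
  have "n $ i * (p $ i - a $ i) = n $ i * (r * sgn (n $ i))"
    using assms(6)[of i] by (simp add: mult_sgn_self mult.left_commute)
  then show "p $ i = a $ i + r * sgn (n $ i)"
    using nz[of i] by simp
qed

text \<open>At positive distance the normal \<open>n\<close> is the same for all nearest points and
  has no zero coordinate, so every nearest point is the same corner of the square. At distance zero
  the only candidate is \<open>a\<close>.\<close>

lemma metric_projection_singleton:
  assumes "convex S" "closed S" "S \<noteq> {}" "a \<in> rectangle hull S"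
  shows "is_singleton (metric_projection a S)"
proof -
  obtain p where p: "p \<in> S" "infnorm (p - a) = uniform_dist a S"
    using uniform_dist_attained[OF assms(2,3)] .
  have "q = p" if q: "q \<in> S" "infnorm (q - a) = uniform_dist a S" for q
  proof (cases "uniform_dist a S = 0")
    case True
    then show ?thesis using p q by (simp add: infnorm_eq_0)
  next
    case False
    then have r: "0 < uniform_dist a S"
      using uniform_dist_nonneg[OF assms(3), of a] by simp
    from separating_normal_square[OF assms(1,3) r uniform_dist_lower]
    obtain n where n: "n \<noteq> 0"
      "\<And>p x. p \<in> S \<Longrightarrow> infnorm (p - a) \<le> uniform_dist a S \<Longrightarrow> x \<in> S \<Longrightarrow> 0 \<le> n \<bullet> (x - p)"
      "\<And>p k. p \<in> S \<Longrightarrow> infnorm (p - a) \<le> uniform_dist a S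
        \<Longrightarrow> n $ k * (p $ k - a $ k) = uniform_dist a S * \<bar>n $ k\<bar>"
      by blast
    have "z $ k = a $ k + uniform_dist a S * sgn (n $ k)"
      if "z \<in> S" "infnorm (z - a) = uniform_dist a S" for z k
      using hull_normal_nonzero(2)[OF assms(4) n(1) that(1) r n(2,3)] that by simp
    then show ?thesis
      using p q by (simp add: vec_eq_iff)
  qed
  then have "x = p" if "x \<in> metric_projection a S" for x
    using that unfolding mem_metric_projection by blast
  then show ?thesis
    using metric_projection_nonempty[OF assms(2,3)] by (intro is_singletonI') blast+
qed

text \<open>
  The corner \<open>p\<close> of the square around \<open>a\<close> can be moved towards \<open>a\<close> inside a single \<open>C\<close>: the
  direction is a convex combination of those to a point \<open>y\<close> of \<open>C\<close> strictly inside the corner's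
  quadrant and to a point \<open>z\<close> of \<open>A\<close> that lies behind \<open>p\<close> in one coordinate only.
\<close>
lemma corner_shift:
  fixes C :: "(real^2) set"
  assumes "convex C" "A \<subseteq> C" "p \<in> A" "a \<in> rectangle hull A" "0 < r"
    and nz: "\<And>k. n $ k \<noteq> 0"
    and p: "\<And>k. p $ k = a $ k + r * sgn (n $ k)"
    and A: "\<And>x. x \<in> A \<Longrightarrow> 0 \<le> n \<bullet> (x - p)"
    and y: "y \<in> C" "infnorm (y - a) < r"
  obtains t where "0 < t" "p - t *\<^sub>R (\<chi> k. sgn (n $ k)) \<in> C"
proof -
  define \<sigma> where "\<sigma> k = sgn (n $ k)" for k
  have ss: "\<sigma> k * (\<sigma> k * w) = w" for k w
    using nz[of k] by (simp add: \<sigma>_def sgn_if)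
  define Y where "Y k = \<sigma> k * (p $ k - y $ k)" for k
  have Y: "y $ k = p $ k - \<sigma> k * Y k" "0 < Y k" for k
  proof -
    show "y $ k = p $ k - \<sigma> k * Y k" by (simp add: Y_def ss)
    have "\<bar>y $ k - a $ k\<bar> < r" using y(2) by (simp add: infnorm_less_iff)
    then show "0 < Y k"
      using nz[of k] p[of k] by (auto simp: Y_def \<sigma>_def sgn_if algebra_simps)
  qed
  obtain i j :: 2 where ij: "i \<noteq> j" "Y i \<le> Y j"
    by (metis (full_types) linear one_neq_zero zero_neq_one exhaust_2 zero_neq_numeral)
  obtain z where z: "z \<in> A" "0 < \<sigma> i * (p $ i - z $ i)"
  proof (rule ccontr)
    assume "\<not> thesis"
    with that have "\<sigma> i * p $ i \<le> \<sigma> i * x $ i" if "x \<in> A" for x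
      using that by (force simp: algebra_simps)
    with assms(3,4) have "\<sigma> i * p $ i \<le> \<sigma> i * a $ i"
      using rectangle_hull_lower by blast
    then show False
      using assms(5) nz[of i] by (simp add: p ring_distribs ss \<sigma>_def sgn_if split: if_splits)
  qed
  define Z where "Z k = \<sigma> k * (p $ k - z $ k)" for k
  have Z: "z $ k = p $ k - \<sigma> k * Z k" for k
    by (simp add: Z_def ss)
  have "n $ k * (z - p) $ k = - (\<bar>n $ k\<bar> * Z k)" for k
    using nz[of k] by (simp add: Z_def \<sigma>_def sgn_if algebra_simps)
  then have "\<bar>n $ i\<bar> * Z i + \<bar>n $ j\<bar> * Z j \<le> 0"
    using A[OF z(1)] by (simp add: inner_pair[OF ij(1)])
  moreover have "0 < \<bar>n $ i\<bar> * Z i"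
    using z(2) nz[of i] by (simp add: Z_def)
  ultimately have "\<bar>n $ j\<bar> * Z j < 0" by linarith
  then have Zj: "Z j < 0" "0 < Z i"
    using z(2) by (simp_all add: mult_less_0_iff Z_def)
  define D where "D = (Y j - Y i) + (Z i - Z j)"
  \<comment> \<open>The weight at which the combined offsets in the coordinates \<open>i\<close> and
    \<open>j\<close> agree, which puts the combination of \<open>y\<close> and \<open>z\<close> on
    the diagonal through \<open>p\<close>. It is nonnegative because
    \<open>Y i \<le> Y j\<close>.\<close>
  define s where "s = (Y j - Y i) / D"
  have D: "0 < D" using ij(2) Zj by (simp add: D_def)
  have s: "0 \<le> s" "s \<le> 1" using D ij(2) Zj by (simp_all add: s_def D_def field_simps)
  define t where "t = (1 - s) * Y i + s * Z i"
  have "s * D = Y j - Y i" using D by (simp add: s_def)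
  then have tj: "t = (1 - s) * Y j + s * Z j"
    by (simp add: t_def D_def algebra_simps)
  have "0 < t"
    using s Y(2)[of i] Zj(2) by (cases "s = 0") (auto simp: t_def intro!: add_nonneg_pos)
  moreover have "p - t *\<^sub>R (\<chi> k. sgn (n $ k)) = (1 - s) *\<^sub>R y + s *\<^sub>R z"
  proof (rule vec_eq_iff[THEN iffD2], rule allI)
    fix k
    have "k = i \<or> k = j" by (rule index_pair[OF ij(1)])
    then have "t = (1 - s) * Y k + s * Z k" using t_def tj by auto
    then have "t * \<sigma> k = ((1 - s) * Y k + s * Z k) * \<sigma> k" by simp
    then show "(p - t *\<^sub>R (\<chi> k. sgn (n $ k))) $ k = ((1 - s) *\<^sub>R y + s *\<^sub>R z) $ k"
      by (simp add: Y(1) Z \<sigma>_def algebra_simps)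
  qed
  moreover have "(1 - s) *\<^sub>R y + s *\<^sub>R z \<in> C"
    using assms(1,2) y(1) z(1) s by (intro convexD) auto
  ultimately show thesis using that by metis
qed

text \<open>If every \<open>C u\<close> met the open square, each would contain a point on the
  diagonal from \<open>p\<close> towards \<open>a\<close>. As \<open>M\<close> is finite, one such
  point would lie in all of them, hence in \<open>A\<close>, and be closer to \<open>a\<close> than
  \<open>p\<close>. So some \<open>C u\<close> misses the open square and can be separated from
  it.\<close>

lemma corner_supporting_normal:
  fixes C :: "'a \<Rightarrow> (real^2) set"
  assumes "finite M" and C: "\<And>u. u \<in> M \<Longrightarrow> convex (C u)" and A: "A = (\<Inter>u\<in>M. C u)"
    and "a \<in> rectangle hull A" "p \<in> metric_projection a A" "p \<noteq> a"
  obtains u n where "u \<in> M" "\<And>k. n $ k \<noteq> 0"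
    and "\<And>k. p $ k = a $ k + uniform_dist a A * sgn (n $ k)"
    and "\<And>x. x \<in> C u \<Longrightarrow> 0 \<le> n \<bullet> (x - p)"
proof -
  define r where "r = uniform_dist a A"
  have p: "p \<in> A" "infnorm (p - a) \<le> r" "infnorm (p - a) = r"
    using assms(5) by (auto simp: mem_metric_projection r_def)
  have r: "0 < r" using p(3) assms(6) infnorm_pos_lt[of "p - a"] by simp
  have "convex A" unfolding A using C by (rule convex_INT)
  then obtain n where n: "n \<noteq> 0" "\<And>x. x \<in> A \<Longrightarrow> 0 \<le> n \<bullet> (x - p)"
      "\<And>k. n $ k * (p $ k - a $ k) = r * \<bar>n $ k\<bar>"
    using separating_normal_square[of A r a] p r uniform_dist_lower[of _ A a]
    unfolding r_def by (metis empty_iff)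
  note corner = hull_normal_nonzero[OF assms(4) n(1) p(1) r n(2,3)]
  let ?\<sigma> = "\<chi> k. sgn (n $ k)"
  obtain u where u: "u \<in> M" "\<And>y. y \<in> C u \<Longrightarrow> r \<le> infnorm (y - a)"
  proof (rule ccontr)
    assume "\<not> thesis"
    with that have *: "\<exists>y\<in>C u. infnorm (y - a) < r" if "u \<in> M" for u
      using that by (meson not_le)
    have "\<exists>t>0. p - t *\<^sub>R ?\<sigma> \<in> C u" if u: "u \<in> M" for u
    proof -
      obtain y where y: "y \<in> C u" "infnorm (y - a) < r" using *[OF u] by auto
      have "A \<subseteq> C u" using u A by auto
      from corner_shift[OF C[OF u] this p(1) assms(4) r corner n(2) y]
      show ?thesis by blast
    qed
    then obtain t where t: "\<And>u. u \<in> M \<Longrightarrow> 0 < t u" "\<And>u. u \<in> M \<Longrightarrow> p - t u *\<^sub>R ?\<sigma> \<in> C u"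
      by metis
    \<comment> \<open>Including \<open>r\<close> in the minimum prevents the shift from going beyond
      \<open>a\<close>.\<close>
    define t0 where "t0 = Min (insert r (t ` M))"
    have t0: "0 < t0" "t0 \<le> r" "\<And>u. u \<in> M \<Longrightarrow> t0 \<le> t u"
      using t(1) r assms(1) by (auto simp: t0_def)
    have "p - t0 *\<^sub>R ?\<sigma> \<in> C u" if u: "u \<in> M" for u
    proof -
      have "(1 - t0 / t u) *\<^sub>R p + (t0 / t u) *\<^sub>R (p - t u *\<^sub>R ?\<sigma>) \<in> C u"
        using C[OF u] t[OF u] t0(1) t0(3)[OF u] p(1) u A
        by (intro convexD) auto
      moreover have "(1 - t0 / t u) *\<^sub>R p + (t0 / t u) *\<^sub>R (p - t u *\<^sub>R ?\<sigma>) = p - t0 *\<^sub>R ?\<sigma>"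
        using t(1)[OF u] by (simp add: algebra_simps)
      ultimately show ?thesis by simp
    qed
    then have "r \<le> infnorm (p - t0 *\<^sub>R ?\<sigma> - a)"
      unfolding r_def using A by (intro uniform_dist_lower) auto
    moreover have "infnorm (p - t0 *\<^sub>R ?\<sigma> - a) \<le> r - t0"
      unfolding infnorm_le_iff
    proof
      fix k
      have "(p - t0 *\<^sub>R ?\<sigma> - a) $ k = (r - t0) * sgn (n $ k)"
        by (simp add: corner(2) algebra_simps)
      then show "\<bar>(p - t0 *\<^sub>R ?\<sigma> - a) $ k\<bar> \<le> r - t0"
        using t0(2) corner(1)[of k] by (simp add: abs_mult abs_sgn_eq)
    qed
    ultimately show False using t0(1) by simp
  qed
  have sub: "A \<subseteq> C u" using u(1) A by auto
  with p(1) have pu: "p \<in> C u" by auto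
  \<comment> \<open>The normal \<open>n\<close> is known to support only \<open>A\<close>; a second
    separation provides one for the larger set \<open>C u\<close>. It supports \<open>A\<close> too,
    so its coordinates are nonzero for the same reason.\<close>
  then obtain m where m: "m \<noteq> 0" "\<And>x. x \<in> C u \<Longrightarrow> 0 \<le> m \<bullet> (x - p)"
      "\<And>k. m $ k * (p $ k - a $ k) = r * \<bar>m $ k\<bar>"
    using separating_normal_square[OF C[OF u(1)] _ r u(2)] p(2) by (metis empty_iff)
  have "0 \<le> m \<bullet> (x - p)" if "x \<in> A" for x
    using m(2) sub that by auto
  note corner' = hull_normal_nonzero[OF assms(4) m(1) p(1) r this m(3)]
  show thesis
    by (rule that[OF u(1) corner'[unfolded r_def] m(2)])
qed

section \<open>Comparison of two corners\<close>

lemma inner_sgn_pair: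
  fixes n x :: "real^2"
  assumes "i \<noteq> j"
  shows "n \<bullet> x = \<bar>n $ i\<bar> * (sgn (n $ i) * x $ i) + \<bar>n $ j\<bar> * (sgn (n $ j) * x $ j)"
  by (simp add: inner_pair[OF assms] mult.assoc[symmetric] abs_mult_sgn)

text \<open>Replacing \<open>z\<close> by a nearby point of \<open>B\<close> changes the inner
  product by at most \<open>\<delta>\<close> times the 1-norm of \<open>n\<close>, the dual norm of
  \<open>infnorm\<close>.\<close>

lemma close_within_supporting_normal:
  assumes "close_within \<delta> A B" "\<And>x. x \<in> B \<Longrightarrow> 0 \<le> n \<bullet> (x - p)" "z \<in> A" "i \<noteq> j"
  shows "- (\<delta> * (\<bar>n $ i\<bar> + \<bar>n $ j\<bar>)) \<le> n \<bullet> (z - p)"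
proof -
  obtain w where w: "w \<in> B" "infnorm (z - w) \<le> \<delta>"
    using assms(1,3) by (auto simp: close_within_def)
  have "\<bar>n $ k * (z - w) $ k\<bar> \<le> \<bar>n $ k\<bar> * \<delta>" for k
    using w(2) unfolding abs_mult infnorm_le_iff by (intro mult_left_mono) auto
  from this[of i] this[of j] have "- (\<delta> * (\<bar>n $ i\<bar> + \<bar>n $ j\<bar>)) \<le> n \<bullet> (z - w)"
    unfolding inner_pair[OF assms(4)] by (simp add: algebra_simps)
  moreover have "n \<bullet> (z - p) = n \<bullet> (z - w) + n \<bullet> (w - p)"
    by (simp add: inner_diff_right)
  ultimately show ?thesis using assms(2)[OF w(1)] by linarith
qed

text \<open>An infimum of a coordinate over \<open>A\<close> need not be attained, whence the slack
  \<open>\<eta>\<close>.\<close>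

lemma hull_point_near:
  fixes c :: real
  assumes "a \<in> rectangle hull A" "A \<noteq> {}" "0 < \<eta>"
  obtains z where "z \<in> A" "c * (z $ k - a $ k) \<le> \<eta>"
proof (rule ccontr)
  assume "\<not> thesis"
  with that have "c * a $ k + \<eta> \<le> c * x $ k" if "x \<in> A" for x
    using that by (force simp: algebra_simps not_le)
  from rectangle_hull_lower[OF assms(1,2) this] show False
    using assms(3) by simp
qed

text \<open>\<open>X\<close> is eliminated by multiplying the first inequality by
  \<open>\<mu>\<^sub>i\<close> and the second by \<open>\<nu>\<^sub>i\<close>. Positivity of
  \<open>e\<close> makes the result strict, and \<open>2 * \<eta> \<le> e\<close> bounds
  \<open>r - e + \<eta>\<close> by the factor \<open>r - \<eta>\<close>, which then cancels.\<close>

lemma slope_less: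
  fixes e r X \<eta> :: real
  assumes "0 < \<nu>\<^sub>i" "0 < \<mu>\<^sub>i" "0 < \<mu>\<^sub>j" "0 < e" "\<eta> < r" "2 * \<eta> \<le> e"
    and 1: "\<nu>\<^sub>j * (r - \<eta>) \<le> \<nu>\<^sub>i * X" and 2: "\<mu>\<^sub>i * (e + X) \<le> \<mu>\<^sub>j * (r - e + \<eta>)"
  shows "\<mu>\<^sub>i * \<nu>\<^sub>j < \<mu>\<^sub>j * \<nu>\<^sub>i"
proof -
  have "\<mu>\<^sub>i * \<nu>\<^sub>j * (r - \<eta>) \<le> \<mu>\<^sub>i * (\<nu>\<^sub>i * X)"
    using 1 assms(2) by (simp add: mult.assoc)
  also have "\<dots> < \<nu>\<^sub>i * (\<mu>\<^sub>i * (e + X))"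
    using assms(1,2,4) by (simp add: algebra_simps)
  also have "\<dots> \<le> \<nu>\<^sub>i * (\<mu>\<^sub>j * (r - e + \<eta>))"
    using 2 assms(1) by simp
  also have "\<dots> \<le> \<nu>\<^sub>i * (\<mu>\<^sub>j * (r - \<eta>))"
    using assms(1,3,6) by simp
  finally have "\<mu>\<^sub>i * \<nu>\<^sub>j * (r - \<eta>) < \<mu>\<^sub>j * \<nu>\<^sub>i * (r - \<eta>)"
    by (simp add: ac_simps)
  then show ?thesis using assms(5) by simp
qed

text \<open>
  If the corners \<open>p\<close> and \<open>q\<close> agree in direction \<open>j\<close> and are opposite in direction \<open>i\<close>, a point
  of \<open>A\<close> behind \<open>a\<close> in direction \<open>j\<close> compares the slopes of the two supporting lines. The
  hypotheses are symmetric in the two corners while the conclusion is not.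
\<close>
lemma opposite_corner_slope:
  fixes n m p q :: "real^2"
  assumes ij: "i \<noteq> j" and nz: "\<And>k. n $ k \<noteq> 0" "\<And>k. m $ k \<noteq> 0"
    and p: "\<And>k. p $ k = a $ k + r * sgn (n $ k)" and q: "\<And>k. q $ k = b $ k + s * sgn (m $ k)"
    and r: "0 < r" and close: "\<And>k. \<bar>a $ k - b $ k\<bar> \<le> \<delta>\<^sub>2"
    and n: "\<And>x. x \<in> A \<Longrightarrow> 0 \<le> n \<bullet> (x - p)"
    and m: "\<And>x. x \<in> A \<Longrightarrow> - (\<delta>\<^sub>1 * (\<bar>m $ i\<bar> + \<bar>m $ j\<bar>)) \<le> m \<bullet> (x - q)"
    and hull: "a \<in> rectangle hull A" "A \<noteq> {}"
    and sgn_i: "sgn (m $ i) = - sgn (n $ i)" and sgn_j: "sgn (m $ j) = sgn (n $ j)"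
    and e: "0 < r + s - (\<delta>\<^sub>1 + \<delta>\<^sub>2)"
  shows "\<bar>m $ i\<bar> * \<bar>n $ j\<bar> < \<bar>m $ j\<bar> * \<bar>n $ i\<bar>"
proof -
  define e where "e = r + s - (\<delta>\<^sub>1 + \<delta>\<^sub>2)"
  define \<eta> where "\<eta> = min (e / 2) (r / 2)"
  have \<eta>: "0 < \<eta>" "2 * \<eta> \<le> e" "\<eta> < r" and e0: "0 < e"
    using e r by (auto simp: \<eta>_def e_def min_def)
  define \<sigma> where "\<sigma> k = sgn (n $ k)" for k
  have \<sigma>: "\<sigma> k = 1 \<or> \<sigma> k = -1" for k
    using nz(1)[of k] by (auto simp: \<sigma>_def sgn_if)
  have s1: "\<sigma> k * (a $ k - b $ k) \<le> \<delta>\<^sub>2" "\<sigma> k * (b $ k - a $ k) \<le> \<delta>\<^sub>2" for k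
    using close[of k] \<sigma>[of k] by auto
  obtain z where z: "z \<in> A" "\<sigma> j * (z $ j - a $ j) \<le> \<eta>"
    using hull_point_near[OF hull \<eta>(1)] by metis
  define X where "X = \<sigma> i * (z $ i - p $ i)"
  have pj: "\<sigma> j * (z $ j - p $ j) = \<sigma> j * (z $ j - a $ j) - r"
    using \<sigma>[of j] by (auto simp: p \<sigma>_def[symmetric])
  have qj: "\<sigma> j * (z $ j - q $ j) \<le> \<eta> + \<delta>\<^sub>2 - s"
    using \<sigma>[of j] z(2) s1[of j] by (auto simp: q sgn_j \<sigma>_def[symmetric])
  have qi: "- \<sigma> i * (z $ i - q $ i) \<le> \<delta>\<^sub>2 - r - s - X"
    using \<sigma>[of i] s1[of i] by (auto simp: X_def p q sgn_i \<sigma>_def[symmetric])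
  \<comment> \<open>Tested at \<open>z\<close>, the line at \<open>p\<close> bounds \<open>X\<close>
    from below; the line at \<open>q\<close>, relaxed by \<open>\<delta>\<^sub>1\<close>, then
    bounds it from above.\<close>
  have "0 \<le> \<bar>n $ i\<bar> * X + \<bar>n $ j\<bar> * (\<sigma> j * (z $ j - p $ j))"
    using n[OF z(1)] by (simp add: inner_sgn_pair[OF ij] X_def \<sigma>_def)
  also have "\<dots> \<le> \<bar>n $ i\<bar> * X + \<bar>n $ j\<bar> * (\<eta> - r)"
    using z(2) by (intro add_left_mono mult_left_mono) (auto simp: pj)
  finally have 1: "\<bar>n $ j\<bar> * (r - \<eta>) \<le> \<bar>n $ i\<bar> * X"
    by (simp add: algebra_simps)
  have "- (\<delta>\<^sub>1 * (\<bar>m $ i\<bar> + \<bar>m $ j\<bar>)) \<le>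
      \<bar>m $ i\<bar> * (- \<sigma> i * (z $ i - q $ i)) + \<bar>m $ j\<bar> * (\<sigma> j * (z $ j - q $ j))"
    using m[OF z(1)] by (simp add: inner_sgn_pair[OF ij] sgn_i sgn_j \<sigma>_def)
  also have "\<dots> \<le> \<bar>m $ i\<bar> * (\<delta>\<^sub>2 - r - s - X) + \<bar>m $ j\<bar> * (\<eta> + \<delta>\<^sub>2 - s)"
    using qi qj by (intro add_mono mult_left_mono) auto
  finally have 2: "\<bar>m $ i\<bar> * (e + X) \<le> \<bar>m $ j\<bar> * (r - e + \<eta>)"
    by (simp add: e_def algebra_simps)
  show ?thesis
    by (rule slope_less[OF _ _ _ e0 \<eta>(3,2) 1 2]) (simp_all add: nz)
qed

lemma corner_distance_coordinate:
  fixes n m p q :: "real^2"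
  assumes ij: "i \<noteq> j" and nz: "\<And>k. n $ k \<noteq> 0" "\<And>k. m $ k \<noteq> 0"
    and p: "\<And>k. p $ k = a $ k + r * sgn (n $ k)" and q: "\<And>k. q $ k = b $ k + s * sgn (m $ k)"
    and rs: "0 < r" "0 < s" and close: "\<And>k. \<bar>a $ k - b $ k\<bar> \<le> \<delta>\<^sub>2"
    and nA: "\<And>x. x \<in> A \<Longrightarrow> 0 \<le> n \<bullet> (x - p)"
    and mA: "\<And>x. x \<in> A \<Longrightarrow> - (\<delta>\<^sub>1 * (\<bar>m $ i\<bar> + \<bar>m $ j\<bar>)) \<le> m \<bullet> (x - q)"
    and mB: "\<And>x. x \<in> B \<Longrightarrow> 0 \<le> m \<bullet> (x - q)"
    and nB: "\<And>x. x \<in> B \<Longrightarrow> - (\<delta>\<^sub>1 * (\<bar>n $ i\<bar> + \<bar>n $ j\<bar>)) \<le> n \<bullet> (x - p)"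
    and A: "a \<in> rectangle hull A" "p \<in> A" and B: "b \<in> rectangle hull B" "q \<in> B"
  shows "\<bar>p $ i - q $ i\<bar> \<le> \<delta>\<^sub>1 + 2 * \<delta>\<^sub>2"
proof -
  have \<sigma>: "sgn (n $ k) = 1 \<or> sgn (n $ k) = -1" and \<tau>: "sgn (m $ k) = 1 \<or> sgn (m $ k) = -1" for k
    using nz[of k] by (auto simp: sgn_if)
  \<comment> \<open>A common bound \<open>t\<close> for both signed coordinates lets the 1-norm of
    \<open>l\<close> be divided out.\<close>
  have average: "0 \<le> \<delta>\<^sub>1 + t"
    if "\<And>k. sgn (l $ k) * y $ k \<le> t" "- (\<delta>\<^sub>1 * (\<bar>l $ i\<bar> + \<bar>l $ j\<bar>)) \<le> l \<bullet> y" "l $ i \<noteq> 0"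
    for l y :: "real^2" and t
  proof -
    have "- (\<delta>\<^sub>1 * (\<bar>l $ i\<bar> + \<bar>l $ j\<bar>)) \<le> \<bar>l $ i\<bar> * t + \<bar>l $ j\<bar> * t"
      using that(2) mult_left_mono[OF that(1)[of i], of "\<bar>l $ i\<bar>"]
        mult_left_mono[OF that(1)[of j], of "\<bar>l $ j\<bar>"]
      unfolding inner_sgn_pair[OF ij] by linarith
    then have "0 \<le> (\<delta>\<^sub>1 + t) * (\<bar>l $ i\<bar> + \<bar>l $ j\<bar>)"
      by (simp add: algebra_simps)
    moreover have "0 < \<bar>l $ i\<bar> + \<bar>l $ j\<bar>" using that(3) by linarith
    ultimately show ?thesis by (simp add: zero_le_mult_iff)
  qed
  \<comment> \<open>Testing each supporting line at the other corner bounds the difference of the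
    two radii.\<close>
  have "sgn (n $ k) * (q - p) $ k \<le> \<delta>\<^sub>2 + s - r" for k
    using \<sigma>[of k] \<tau>[of k] close[of k] rs by (auto simp: p q)
  from average[OF this nB[OF B(2)] nz(1)] have r_le: "r \<le> s + \<delta>\<^sub>1 + \<delta>\<^sub>2" by linarith
  have "sgn (m $ k) * (p - q) $ k \<le> \<delta>\<^sub>2 + r - s" for k
    using \<sigma>[of k] \<tau>[of k] close[of k] rs by (auto simp: p q)
  from average[OF this mA[OF A(2)] nz(2)] have s_le: "s \<le> r + \<delta>\<^sub>1 + \<delta>\<^sub>2" by linarith
  show ?thesis
  proof (cases "sgn (m $ i) = sgn (n $ i)")
    case True
    then show ?thesis
      using \<sigma>[of i] close[of i] r_le s_le by (auto simp: p q)
  next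
    case False
    then have i: "sgn (m $ i) = - sgn (n $ i)"
      using \<sigma>[of i] \<tau>[of i] by auto
    have "r + s \<le> \<delta>\<^sub>1 + \<delta>\<^sub>2"
    proof (cases "sgn (m $ j) = sgn (n $ j)")
      case True
      show ?thesis
      \<comment> \<open>Otherwise the slopes of the two lines would compare strictly in both
        directions, once through \<open>A\<close> and once through \<open>B\<close>.\<close>
      proof (rule ccontr)
        assume "\<not> ?thesis"
        then have e: "0 < r + s - (\<delta>\<^sub>1 + \<delta>\<^sub>2)" "0 < s + r - (\<delta>\<^sub>1 + \<delta>\<^sub>2)" by auto
        have close': "\<bar>b $ k - a $ k\<bar> \<le> \<delta>\<^sub>2" for k
          using close[of k] by linarith
        have "A \<noteq> {}" "B \<noteq> {}" using A B by auto
        have "\<bar>m $ i\<bar> * \<bar>n $ j\<bar> < \<bar>m $ j\<bar> * \<bar>n $ i\<bar>"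
          by (rule opposite_corner_slope[OF ij nz p q rs(1) close nA mA A(1) \<open>A \<noteq> {}\<close> i True e(1)])
        moreover have "\<bar>n $ i\<bar> * \<bar>m $ j\<bar> < \<bar>n $ j\<bar> * \<bar>m $ i\<bar>"
          by (rule opposite_corner_slope[OF ij nz(2,1) q p rs(2) close' mB nB B(1) \<open>B \<noteq> {}\<close> _ _ e(2)])
            (simp_all add: i True)
        ultimately show False by (simp add: mult.commute)
      qed
    next
      case False
      then have j: "sgn (m $ j) = - sgn (n $ j)"
        using \<sigma>[of j] \<tau>[of j] by auto
      \<comment> \<open>With both coordinates opposite, \<open>q\<close> lies so far behind
        \<open>p\<close> that the line at \<open>p\<close> alone bounds the sum of the
        radii.\<close>
      have "sgn (n $ k) * (q - p) $ k \<le> \<delta>\<^sub>2 - s - r" for k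
        using index_pair[OF ij, of k] i j \<sigma>[of k] close[of k] by (auto simp: p q)
      from average[OF this nB[OF B(2)] nz(1)] show ?thesis by linarith
    qed
    then show ?thesis
      using \<sigma>[of i] close[of i] rs by (auto simp: p q i)
  qed
qed

text \<open>The corner estimate is applied in each coordinate. If \<open>p = a\<close> or
  \<open>q = b\<close>, the square has radius zero and offers no corner, so these cases are treated
  separately.\<close>

lemma projection_distance:
  fixes C D :: "'a \<Rightarrow> (real^2) set"
  assumes "finite M" and C: "\<And>u. u \<in> M \<Longrightarrow> convex (C u)" and D: "\<And>u. u \<in> M \<Longrightarrow> convex (D u)"
    and A: "A = (\<Inter>u\<in>M. C u)" and B: "B = (\<Inter>u\<in>M. D u)"
    and CD: "\<And>u. u \<in> M \<Longrightarrow> close_within \<delta>\<^sub>1 (C u) (D u)"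
    and DC: "\<And>u. u \<in> M \<Longrightarrow> close_within \<delta>\<^sub>1 (D u) (C u)"
    and a: "a \<in> rectangle hull A" and b: "b \<in> rectangle hull B"
    and ab: "infnorm (a - b) \<le> \<delta>\<^sub>2" and "0 \<le> \<delta>\<^sub>1"
    and p: "p \<in> metric_projection a A" and q: "q \<in> metric_projection b B"
  shows "infnorm (p - q) \<le> \<delta>\<^sub>1 + 2 * \<delta>\<^sub>2"
proof -
  have close: "\<bar>a $ k - b $ k\<bar> \<le> \<delta>\<^sub>2" for k
    using ab by (simp add: infnorm_le_iff)
  \<comment> \<open>For use when the other square is a point: then \<open>b'\<close> lies in every
    \<open>D' u\<close>, and testing the supporting line there bounds the radius of the remaining
    square.\<close>
  have one_side: "infnorm (p' - a') \<le> \<delta>\<^sub>1 + infnorm (a' - b')"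
    if CM: "\<And>u. u \<in> M \<Longrightarrow> convex (C' u)" and a': "a' \<in> rectangle hull (\<Inter>u\<in>M. C' u)"
      and p'mem: "p' \<in> metric_projection a' (\<Inter>u\<in>M. C' u)"
      and close': "\<And>u. u \<in> M \<Longrightarrow> close_within \<delta>\<^sub>1 (D' u) (C' u)" and b': "b' \<in> (\<Inter>u\<in>M. D' u)"
    for C' D' :: "'a \<Rightarrow> (real^2) set" and a' b' p'
  proof (cases "p' = a'")
    case True
    then show ?thesis using assms(11) by (simp add: infnorm_0 infnorm_pos_le)
  next
    case False
    define r where "r = uniform_dist a' (\<Inter>u\<in>M. C' u)"
    have r: "infnorm (p' - a') = r"
      using p'mem by (simp add: mem_metric_projection r_def)
    obtain u n where u: "u \<in> M" and nz: "\<And>k. n $ k \<noteq> 0"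
      and p': "\<And>k. p' $ k = a' $ k + r * sgn (n $ k)"
      and n: "\<And>x. x \<in> C' u \<Longrightarrow> 0 \<le> n \<bullet> (x - p')"
      using corner_supporting_normal[OF assms(1) CM refl a' p'mem False] unfolding r_def by metis
    have ij: "1 \<noteq> (2::2)" by simp
    have "- (\<delta>\<^sub>1 * (\<bar>n $ 1\<bar> + \<bar>n $ 2\<bar>)) \<le> n \<bullet> (b' - p')"
      using b' u by (intro close_within_supporting_normal[OF close'[OF u] n _ ij]) auto
    also have "\<dots> \<le> \<bar>n $ 1\<bar> * (infnorm (a' - b') - r) + \<bar>n $ 2\<bar> * (infnorm (a' - b') - r)"
    proof -
      have "sgn (n $ k) * (b' - p') $ k \<le> infnorm (a' - b') - r" for k
        using nz[of k] infnorm_le_iff[of "a' - b'" "infnorm (a' - b')"]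
        by (auto simp: p' sgn_if abs_le_iff algebra_simps)
      then show ?thesis
        unfolding inner_sgn_pair[OF ij] by (intro add_mono mult_left_mono) auto
    qed
    finally have "0 \<le> (\<delta>\<^sub>1 + infnorm (a' - b') - r) * (\<bar>n $ 1\<bar> + \<bar>n $ 2\<bar>)"
      by (simp add: algebra_simps)
    moreover have "0 < \<bar>n $ 1\<bar> + \<bar>n $ 2\<bar>" using nz[of 1] by linarith
    ultimately show ?thesis by (simp add: r zero_le_mult_iff)
  qed
  have pA: "p \<in> A" and qB: "q \<in> B" using p q by (auto simp: mem_metric_projection)
  consider "q = b" | "p = a" | "p \<noteq> a" "q \<noteq> b" by blast
  then show ?thesis
  proof cases
    case 1
    have "infnorm (p - a) \<le> \<delta>\<^sub>1 + infnorm (a - b)"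
      using one_side[where C' = C and D' = D and a' = a and b' = b and p' = p] C a p DC qB A B 1 by simp
    then show ?thesis
      using infnorm_triangle[of "p - a" "a - b"] ab 1 by simp
  next
    case 2
    have "infnorm (q - b) \<le> \<delta>\<^sub>1 + infnorm (b - a)"
      using one_side[where C' = D and D' = C and a' = b and b' = a and p' = q] D b q CD pA A B 2 by simp
    then show ?thesis
      using infnorm_triangle[of "a - b" "b - q"] ab 2 by (simp add: infnorm_sub)
  next
    case 3
    have rs: "0 < uniform_dist a A" "0 < uniform_dist b B"
      using p q 3 infnorm_pos_lt[of "p - a"] infnorm_pos_lt[of "q - b"]
      by (auto simp: mem_metric_projection)
    obtain u n where u: "u \<in> M" and n: "\<And>k. n $ k \<noteq> 0"
      "\<And>k. p $ k = a $ k + uniform_dist a A * sgn (n $ k)"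
      "\<And>x. x \<in> C u \<Longrightarrow> 0 \<le> n \<bullet> (x - p)"
      using corner_supporting_normal[OF assms(1) C A a p 3(1)] by metis
    obtain v m where v: "v \<in> M" and m: "\<And>k. m $ k \<noteq> 0"
      "\<And>k. q $ k = b $ k + uniform_dist b B * sgn (m $ k)"
      "\<And>x. x \<in> D v \<Longrightarrow> 0 \<le> m \<bullet> (x - q)"
      using corner_supporting_normal[OF assms(1) D B b q 3(2)] by metis
    have sub: "A \<subseteq> C u" "A \<subseteq> C v" "B \<subseteq> D u" "B \<subseteq> D v"
      using u v A B by auto
    have "\<bar>p $ i - q $ i\<bar> \<le> \<delta>\<^sub>1 + 2 * \<delta>\<^sub>2" if ij: "i \<noteq> j" for i j :: 2
    proof (rule corner_distance_coordinate[OF ij n(1) m(1) n(2) m(2) rs close _ _ _ _ a pA b qB])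
      show "0 \<le> n \<bullet> (x - p)" if "x \<in> A" for x using n(3) sub that by auto
      show "0 \<le> m \<bullet> (x - q)" if "x \<in> B" for x using m(3) sub that by auto
      show "- (\<delta>\<^sub>1 * (\<bar>m $ i\<bar> + \<bar>m $ j\<bar>)) \<le> m \<bullet> (x - q)" if "x \<in> A" for x
        using sub that by (intro close_within_supporting_normal[OF CD[OF v] m(3) _ ij]) auto
      show "- (\<delta>\<^sub>1 * (\<bar>n $ i\<bar> + \<bar>n $ j\<bar>)) \<le> n \<bullet> (x - p)" if "x \<in> B" for x
        using sub that by (intro close_within_supporting_normal[OF DC[OF u] n(3) _ ij]) auto
    qed
    from this[of 1 2] this[of 2 1] show ?thesis
      by (simp add: infnorm_2)
  qed
qed

section \<open>Refinements and the guarantees of the algorithm\<close>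

lemma is_interval_INT:
  fixes S :: "'a \<Rightarrow> (real^'n) set"
  assumes "\<And>u. u \<in> M \<Longrightarrow> is_interval (S u)"
  shows "is_interval (\<Inter>u\<in>M. S u)"
  unfolding is_interval_cart
proof (intro ballI allI impI INT_I)
  fix x y w u
  assume "x \<in> (\<Inter>u\<in>M. S u)" "y \<in> (\<Inter>u\<in>M. S u)" and u: "u \<in> M"
    and w: "\<forall>i. x $ i \<le> w $ i \<and> w $ i \<le> y $ i \<or> y $ i \<le> w $ i \<and> w $ i \<le> x $ i"
  then have "x \<in> S u" "y \<in> S u" by auto
  then show "w \<in> S u"
    by (rule mem_is_interval_between[OF assms[OF u]]) (rule spec[OF w])
qed

lemma closed_refinement:
  "(\<And>u. u \<in> M \<Longrightarrow> closed (G u)) \<Longrightarrow> closed (refinement M \<rho> G l x)"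
  unfolding refinement_def by (intro closed_INT ballI closed_plus_dilated)

lemma rectangle_refinement:
  assumes "\<And>u. u \<in> M \<Longrightarrow> rectangle (G u)" "refinement M \<rho> G l x \<noteq> {}"
  shows "rectangle (refinement M \<rho> G l x)"
proof -
  have "is_interval (G u + dilated_unit_square s)" if "u \<in> M" for u s
    using assms(1)[OF that] by (intro is_interval_plus_dilated) (simp add: rectangle_iff)
  then have "is_interval (refinement M \<rho> G l x)"
    unfolding refinement_def by (intro is_interval_INT)
  moreover have "closed (refinement M \<rho> G l x)"
    using assms(1) by (intro closed_refinement) (simp add: rectangle_iff)
  ultimately show ?thesis
    using assms(2) by (simp add: rectangle_iff)
qed

lemma refinement_subset:
  assumes "x \<in> M" "\<rho> x x = 0"
  shows "refinement M \<rho> G l x \<subseteq> G x"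
proof
  fix p assume "p \<in> refinement M \<rho> G l x"
  then obtain z where "z \<in> G x" "ennreal (infnorm (p - z)) \<le> scaled_dist l (\<rho> x x)"
    using assms(1) by (auto simp: mem_refinement)
  moreover from this(2) have "infnorm (p - z) = 0"
    using assms(2) infnorm_pos_le[of "p - z"] by (simp add: scaled_dist_def ennreal_eq_0_iff)
  ultimately show "p \<in> G x" by (simp add: infnorm_eq_0)
qed

lemma close_within_refinement_summand:
  assumes "0 \<le> l" "pseudometric_on M \<rho>" "x \<in> M" "y \<in> M" "u \<in> M" "\<rho> x y \<noteq> top"
  shows "close_within (l * enn2real (\<rho> x y))
    (G + dilated_unit_square (scaled_dist l (\<rho> x u)))
    (G + dilated_unit_square (scaled_dist l (\<rho> y u)))"
  using assms by (intro close_within_plus_dilated) (auto simp: pseudometric_on_def)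

text \<open>The values \<open>f u\<close> themselves are the required nearby points of
  \<open>G u\<close>. It serves both for \<open>F\<close> and for the rectangular hulls, with the
  minimum of the two constants as \<open>l'\<close>.\<close>

lemma selection_mem_refinement:
  assumes "0 \<le> l" "l' \<le> l" "lip_seminorm M \<rho> f \<le> ennreal l'" "x \<in> M"
    and "\<And>u. u \<in> M \<Longrightarrow> f u \<in> G u"
  shows "f x \<in> refinement M \<rho> G l x"
proof -
  have "lip_seminorm M \<rho> f \<le> ennreal l"
    using assms(2,3) by (meson ennreal_leI order_trans)
  then show ?thesis
    using assms(4,5) by (auto simp: lip_seminorm_le_iff[OF assms(1)] mem_refinement)
qed

theorem theorem1p9:
  fixes M :: "'a set" and \<rho> :: "'a \<Rightarrow> 'a \<Rightarrow> ennreal"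
    and F :: "'a \<Rightarrow> (real^2) set" and l\<^sub>1 l\<^sub>2 :: real
  assumes "0 \<le> l\<^sub>1" and "0 \<le> l\<^sub>2"
    and "finite M" and "pseudometric_on M \<rho>"
    and "\<And>x. x \<in> M \<Longrightarrow> F x \<noteq> {} \<and> convex (F x) \<and> closed (F x)"
  shows
    "(projection_algorithm M \<rho> F l\<^sub>1 l\<^sub>2 = No_go \<longrightarrow>
        \<not> (\<exists>f. lipschitz_selection M \<rho> F f \<and> lip_seminorm M \<rho> f \<le> ennreal (min l\<^sub>1 l\<^sub>2)))
     \<and>
     (\<forall>f. projection_algorithm M \<rho> F l\<^sub>1 l\<^sub>2 = Success f \<longrightarrow>
        f = projection_map M \<rho> F l\<^sub>1 l\<^sub>2
        \<and>
        (\<forall>x\<in>M. refinement M \<rho> F l\<^sub>1 x \<noteq> {}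
             \<and> rectangle (hull_refinement M \<rho> F l\<^sub>1 l\<^sub>2 x)
             \<and> hull_refinement M \<rho> F l\<^sub>1 l\<^sub>2 x \<noteq> {})
        \<and>
        (\<forall>x\<in>M. \<exists>!c. center_of_symmetry c
                        (metric_projection 0 (hull_refinement M \<rho> F l\<^sub>1 l\<^sub>2 x)))
        \<and>
        (\<forall>x\<in>M. is_singleton
                  (metric_projection (center_map M \<rho> F l\<^sub>1 l\<^sub>2 x) (refinement M \<rho> F l\<^sub>1 x)))
        \<and>
        lipschitz_selection M \<rho> F f
        \<and>
        lip_seminorm M \<rho> f \<le> ennreal (l\<^sub>1 + 2 * l\<^sub>2))"
proof (intro conjI impI allI)
  assume "projection_algorithm M \<rho> F l\<^sub>1 l\<^sub>2 = No_go"
  then obtain x where x: "x \<in> M"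
    "refinement M \<rho> F l\<^sub>1 x = {} \<or> hull_refinement M \<rho> F l\<^sub>1 l\<^sub>2 x = {}"
    by (auto simp: projection_algorithm_def split: if_splits)
  show "\<not> (\<exists>f. lipschitz_selection M \<rho> F f \<and> lip_seminorm M \<rho> f \<le> ennreal (min l\<^sub>1 l\<^sub>2))"
  proof
    assume "\<exists>f. lipschitz_selection M \<rho> F f \<and> lip_seminorm M \<rho> f \<le> ennreal (min l\<^sub>1 l\<^sub>2)"
    then obtain f where f: "\<And>u. u \<in> M \<Longrightarrow> f u \<in> F u"
      and lip: "lip_seminorm M \<rho> f \<le> ennreal (min l\<^sub>1 l\<^sub>2)"
      by (auto simp: lipschitz_selection_def)
    note mem = selection_mem_refinement[OF _ _ lip]
    have F1: "f u \<in> refinement M \<rho> F l\<^sub>1 u" if "u \<in> M" for u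
      using assms(1) f that by (intro mem) auto
    then have "f u \<in> hull_map M \<rho> F l\<^sub>1 u" if "u \<in> M" for u
      using that by (auto simp: hull_map_def intro: hull_inc)
    then have "f x \<in> hull_refinement M \<rho> F l\<^sub>1 l\<^sub>2 x"
      unfolding hull_refinement_def using assms(2) x by (intro mem) auto
    with F1 x show False by auto
  qed
next
  fix f assume success: "projection_algorithm M \<rho> F l\<^sub>1 l\<^sub>2 = Success f"
  let ?A = "refinement M \<rho> F l\<^sub>1"
  let ?R = "hull_refinement M \<rho> F l\<^sub>1 l\<^sub>2"
  let ?g = "center_map M \<rho> F l\<^sub>1 l\<^sub>2"
  have \<rho>: "\<rho> x x = 0" "\<rho> x y = \<rho> y x" if "x \<in> M" "y \<in> M" for x y
    using assms(4) that by (auto simp: pseudometric_on_def)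
  from success show f: "f = projection_map M \<rho> F l\<^sub>1 l\<^sub>2"
    by (auto simp: projection_algorithm_def split: if_splits)
  have ne: "?A x \<noteq> {}" "?R x \<noteq> {}" if "x \<in> M" for x
    using success that by (auto simp: projection_algorithm_def split: if_splits)
  have rect_hull: "rectangle (hull_map M \<rho> F l\<^sub>1 x)" if "x \<in> M" for x
    using ne[OF that] by (simp add: hull_map_def rectangle_rectangle_hull)
  have rect: "rectangle (?R x)" if "x \<in> M" for x
    using ne[OF that] rect_hull unfolding hull_refinement_def by (intro rectangle_refinement)
  have convex_summand: "convex (F u + dilated_unit_square s)" if "u \<in> M" for u s
    using assms(5)[OF that] by (intro convex_set_plus convex_dilated_unit_square) auto
  then have "convex (?A x)" for x
    unfolding refinement_def by (intro convex_INT)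
  note A = this closed_refinement[of M F, OF conjunct2[OF conjunct2[OF assms(5)]]]
  show "\<forall>x\<in>M. ?A x \<noteq> {} \<and> rectangle (?R x) \<and> ?R x \<noteq> {}"
    using ne rect by blast
  have ex1: "\<exists>!c. center_of_symmetry c (metric_projection 0 (?R x))" if "x \<in> M" for x
    by (rule ex1_center_of_symmetry[OF rect[OF that]])
  then show "\<forall>x\<in>M. \<exists>!c. center_of_symmetry c (metric_projection 0 (?R x))"
    by blast
  have center: "center_of_symmetry (?g x) (metric_projection 0 (?R x))" if "x \<in> M" for x
    unfolding center_map_def by (rule theI'[OF ex1[OF that]])
  have "?g x \<in> ?R x" if "x \<in> M" for x
    by (rule center_of_symmetry_mem[OF rect[OF that] center[OF that]])
  \<comment> \<open>Because \<open>\<rho> x x = 0\<close>, the refined rectangle lies inside the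
    hull at \<open>x\<close>; membership in the hull is what the corner arguments require.\<close>
  then have g: "?g x \<in> rectangle hull ?A x" if "x \<in> M" for x
    using refinement_subset[of x M \<rho> "hull_map M \<rho> F l\<^sub>1" l\<^sub>2] \<rho>(1) that
    by (auto simp: hull_refinement_def hull_map_def)
  have single: "is_singleton (metric_projection (?g x) (?A x))" if "x \<in> M" for x
    by (rule metric_projection_singleton[OF A ne(1)[OF that] g[OF that]])
  then show "\<forall>x\<in>M. is_singleton (metric_projection (?g x) (?A x))"
    by blast
  have f_mem: "f x \<in> metric_projection (?g x) (?A x)" if "x \<in> M" for x
    using is_singleton_the_elem[THEN iffD1, OF single[OF that]]
    by (auto simp: f projection_map_def)
  have R_close: "close_within (l\<^sub>2 * enn2real (\<rho> x y)) (?R x) (?R y)"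
    if xy: "x \<in> M" "y \<in> M" and fin: "\<rho> x y \<noteq> top" for x y
  proof -
    \<comment> \<open>The Helly argument needs a common point of the sets at \<open>y\<close> to
      clamp, and success of the algorithm provides it.\<close>
    obtain c where "c \<in> ?R y" using ne(2)[OF xy(2)] by auto
    then show ?thesis
      unfolding hull_refinement_def refinement_def[of M \<rho> "hull_map M \<rho> F l\<^sub>1"]
      using rect_hull assms(2)
        close_within_refinement_summand[OF assms(2,4) xy _ fin]
      by (intro close_within_Inter is_interval_plus_dilated) (auto simp: rectangle_iff)
  qed
  have "ennreal (infnorm (f x - f y)) \<le> scaled_dist (l\<^sub>1 + 2 * l\<^sub>2) (\<rho> x y)"
    if xy: "x \<in> M" "y \<in> M" for x y
  proof (cases "\<rho> x y = top")
    case True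
    then show ?thesis by (simp add: scaled_dist_def)
  next
    case fin: False
    let ?d = "enn2real (\<rho> x y)"
    have fin': "\<rho> y x \<noteq> top" and sym: "enn2real (\<rho> y x) = ?d"
      using fin \<rho>(2)[OF xy] by auto
    have "infnorm (?g x - ?g y) \<le> l\<^sub>2 * ?d"
      using R_close[OF xy fin] R_close[OF xy(2,1) fin'] rect center xy
      by (intro center_of_symmetry_close_within[of _ "?R x" "?R y"]) (simp_all add: sym)
    \<comment> \<open>Both refinements are intersections over the same index \<open>u\<close>, and
      their summands at \<open>x\<close> and \<open>y\<close> are pairwise close.\<close>
    then have "infnorm (f x - f y) \<le> l\<^sub>1 * ?d + 2 * (l\<^sub>2 * ?d)"
      using close_within_refinement_summand[OF assms(1,4) xy _ fin]
        close_within_refinement_summand[OF assms(1,4) xy(2,1) _ fin'] assms(1)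
      by (intro projection_distance[OF assms(3) convex_summand convex_summand
            refinement_def refinement_def _ _ g[OF xy(1)] g[OF xy(2)] _ _ f_mem[OF xy(1)] f_mem[OF xy(2)]])
        (simp_all add: sym)
    then have "infnorm (f x - f y) \<le> (l\<^sub>1 + 2 * l\<^sub>2) * ?d"
      by (simp add: algebra_simps)
    then show ?thesis
      using assms(1,2) fin by (simp add: scaled_dist_finite ennreal_leI)
  qed
  then show lip: "lip_seminorm M \<rho> f \<le> ennreal (l\<^sub>1 + 2 * l\<^sub>2)"
    using assms(1,2) by (subst lip_seminorm_le_iff) auto
  have "f x \<in> F x" if "x \<in> M" for x
    using f_mem[OF that] refinement_subset[of x M \<rho> F l\<^sub>1] \<rho>(1) that
    by (auto simp: mem_metric_projection)
  moreover have "lip_seminorm M \<rho> f < top"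
    using lip by (rule le_less_trans) simp
  ultimately show "lipschitz_selection M \<rho> F f"
    by (simp add: lipschitz_selection_def)
qed

end
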